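(* Let $\mathcal{C}$ be a reverse derivative category and $A$ an object of $\mathcal{C}$. Then there is an injective-on-objects 2-functor $$\mathbf{Para}(R_{\mathsf{CoKl}(A\times -)}):\mathbf{Para}(\mathsf{CoKl}(A\times -))\to\mathbf{Para}(\mathbf{Lens}_A(\mathsf{CoKl}(A\times -)))$$ which augments a parametric CoKleisli morphism with its reverse derivative, i.e. which sends an object $X$ to $(X,X)$ and a parametric morphism $(P,f)$, with $f\in\mathsf{CoKl}(A\times -)(P\times X,Y)$, to the pair consisting of the parameter object $(P,P)$ and the lens $(f,\,R_{\mathsf{CoKl}(A\times -)}[f]):(P\times X,P\times X)\to(Y,Y)$.
   Context: Notation: $f\,;g$ denotes composition in diagrammatic order (first $f$, then $g$); $\pi_0,\pi_1$ are binary product projections. "2-functor" between bicategories means a homomorphism of bicategories (pseudofunctor). The subscript in $\mathbf{Lens}_A$ stands for "additive" and is unrelated to the object $A$. **CoKleisli category.** For a cartesian category $\mathcal{C}$ and an object $A$, the product comonad $A\times -$ has comultiplication $\Delta_A\times X$ (with $\Delta_A$ the diagonal) and counit the projection $\pi_X:A\times X\to X$. $\mathsf{CoKl}(A\times -)$ has the objects of $\mathcal{C}$; a morphism $X\to Y$ is a morphism $A\times X\to Y$ in $\mathcal{C}$; the composite of $f:A\times X\to Y$ and $g:A\times Y\to Z$ is $(\Delta_A\times X)\,;(A\times f)\,;g$; the identity is $\pi_X$. It has finite products, given on objects by those of $\mathcal{C}$, and is regarded as a cartesian monoidal category. When $\mathcal{C}$ is left additive, the addition on $\mathsf{CoKl}(A\times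 -)(X,Y)$ is that of $\mathcal{C}(A\times X,Y)$. **Cartesian left additive category.** A category in which every hom-set is a commutative monoid $(+,0)$ with $x\,;(f+g)=x\,;f+x\,;g$ and $x\,;0=0$, with finite products whose projections are additive, where $f$ is additive if $(x+y)\,;f=x\,;f+y\,;f$ and $0\,;f=0$ for all $x,y$. **Reverse derivative category.** A cartesian left additive category with an operator $R$ (the reverse differential combinator) sending each $f:X\to Y$ to $R[f]:X\times Y\to X$, such that, writing $\iota_0=\langle 1,0\rangle$, $\iota_1=\langle 0,1\rangle$ and $D[f]:=(\iota_0\times 1)\,;R[R[f]]\,;\pi_1:X\times X\to Y$ (with $\iota_0:X\to X\times Y$): 1. $R[f+g]=R[f]+R[g]$ and $R[0]=0$. 2. $\langle a,b+c\rangle\,;R[f]=\langle a,b\rangle\,;R[f]+\langle a,c\rangle\,;R[f]$ and $\langle a,0\rangle\,;R[f]=0$. 3. $R[1]=\pi_1$, $R[\pi_0]=\pi_1\,;\iota_0$, $R[\pi_1]=\pi_1\,;\iota_1$. 4. $R[\langle f,g\rangle]=(1\times\pi_0)\,;R[f]+(1\times\pi_1)\,;R[g]$, and $R[!]=0$ for maps $!$ to the terminal object. 5. $R[f\,;g]=\langle\pi_0,\langle\pi_0\,;f,\pi_1\rangle\,;R[g]\rangle\,;R[f]$. 6. $\langle\langle a,b\rangle,\langle 0,d\rangle\rangle\,;D[R[f]]=\langle a,d\rangle\,;R[f]$ for all generalized elements $a,b,d$ of the appropriate types. 7. $\langle\langle a,b\rangle,\langle c,d\rangle\rangle\,;D[D[f]]=\langle\langle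 a,c\rangle,\langle b,d\rangle\rangle\,;D[D[f]]$ for all generalized elements $a,b,c,d$ of the appropriate types. If $\mathcal{C}$ is a reverse derivative category with combinator $R_{\mathcal{C}}$, then $\mathsf{CoKl}(A\times -)$ is regarded as a reverse derivative category with combinator $R_{\mathsf{CoKl}(A\times -)}[f]:=R_{\mathcal{C}}[f]\,;\pi_X:A\times X\times Y\to X$ (composition in $\mathcal{C}$) for $f:A\times X\to Y$. **$\mathbf{Lens}_A(\mathcal{D})$**, for a cartesian left additive category $\mathcal{D}$: objects are pairs $(X,X')$ of objects of $\mathcal{D}$; a morphism $(X,X')\to(Y,Y')$ is a pair of $f:X\to Y$ and $f^*:X\times Y'\to X'$ in $\mathcal{D}$ with $f^*$ additive in its second argument, i.e. $\langle a,b+c\rangle\,;f^*=\langle a,b\rangle\,;f^*+\langle a,c\rangle\,;f^*$ and $\langle a,0\rangle\,;f^*=0$. The composite of $(f,f^* )$ and $(g,g^* )$ is $(f\,;g,\ \langle\pi_0,\langle\pi_0\,;f,\pi_1\rangle\,;g^*\rangle\,;f^* )$; the identity is $(1,\pi_1)$. The monoidal product is $(X,X')\times(Y,Y')=(X\times Y,X'\times Y')$, acting componentwise on morphisms (with the evident permutation of factors in the backward part). For a reverse derivative category $\mathcal{D}$ there is the product-preserving functor $R_{\mathcal{D}}:\mathcal{D}\to\mathbf{Lens}_A(\mathcal{D})$, $X\mapsto(X,X)$, $f\mapsto(f,R_{\mathcal{D}}[f])$. **$\mathbf{Para}(\mathcal{M})$**, for a symmetric monoidal category $(\mathcal{M},\otimes,I)$: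 the bicategory with the objects of $\mathcal{M}$; 1-cells $X\to Y$ are pairs $(P,f)$ with $P$ an object and $f:P\otimes X\to Y$ a morphism of $\mathcal{M}$; a 2-cell $(P',f')\Rightarrow(P,f)$ is a morphism $r:P'\to P$ with $(r\otimes X)\,;f=f'$. The composite of $(P,f):X\to Y$ and $(Q,g):Y\to Z$ is $Q\otimes P$ with $(Q\otimes P)\otimes X\cong Q\otimes(P\otimes X)\xrightarrow{Q\otimes f}Q\otimes Y\xrightarrow{g}Z$; the identity on $X$ is $(I,\lambda_X)$ with $\lambda_X:I\otimes X\to X$ the unitor. 2-cells compose vertically by composition and horizontally by $\otimes$; coherence isomorphisms come from those of $\mathcal{M}$. Here $\mathsf{CoKl}(A\times -)$ carries its cartesian monoidal structure, in which the product of objects is that of $\mathcal{C}$, the unit is the terminal object $1$, and the product of $f:A\times X\to Y$ and $g:A\times X'\to Y'$ is the composite in $\mathcal{C}$ $A\times X\times X'\xrightarrow{\Delta_A\times 1_{X\times X'}}A\times A\times X\times X'\xrightarrow{\mathrm{swap}}A\times X\times A\times X'\xrightarrow{f\times g}Y\times Y'$; and $\mathbf{Lens}_A(\mathsf{CoKl}(A\times -))$ carries the monoidal structure with product $(X,X')\times(Y,Y')=(X\times Y,X'\times Y')$, acting componentwise on morphisms (with the evident permutation of factors in the backward part), and unit $(1,1)$. *)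

theory Defs
  imports Main
begin

text \<open>
  Categories are given by families of hom-sets indexed by pairs of objects. Hom-sets for different
  pairs of objects need not be disjoint, so every operation on morphisms also takes the objects
  involved: \<open>Comp C X Y Z f g\<close> is the composite, in diagrammatic order, of \<open>f : X \<rightarrow> Y\<close> and
  \<open>g : Y \<rightarrow> Z\<close>. Values of the operations outside the carriers are irrelevant.
\<close>

section \<open>Categories with chosen structure\<close>

record ('o, 'm) category =
  Ob :: "'o set"
  Hom :: "'o \<Rightarrow> 'o \<Rightarrow> 'm set"
  Ident :: "'o \<Rightarrow> 'm"
  Comp :: "'o \<Rightarrow> 'o \<Rightarrow> 'o \<Rightarrow> 'm \<Rightarrow> 'm \<Rightarrow> 'm"

locale category =
  fixes C :: "('o, 'm, 'z) category_scheme" (structure)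
  assumes Ident_in: "X \<in> Ob C \<Longrightarrow> Ident C X \<in> Hom C X X"
    and Comp_in: "\<lbrakk>X \<in> Ob C; Y \<in> Ob C; Z \<in> Ob C; f \<in> Hom C X Y; g \<in> Hom C Y Z\<rbrakk>
      \<Longrightarrow> Comp C X Y Z f g \<in> Hom C X Z"
    and Ident_Comp: "\<lbrakk>X \<in> Ob C; Y \<in> Ob C; f \<in> Hom C X Y\<rbrakk> \<Longrightarrow> Comp C X X Y (Ident C X) f = f"
    and Comp_Ident: "\<lbrakk>X \<in> Ob C; Y \<in> Ob C; f \<in> Hom C X Y\<rbrakk> \<Longrightarrow> Comp C X Y Y f (Ident C Y) = f"
    and Comp_assoc: "\<lbrakk>W \<in> Ob C; X \<in> Ob C; Y \<in> Ob C; Z \<in> Ob C;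
        f \<in> Hom C W X; g \<in> Hom C X Y; h \<in> Hom C Y Z\<rbrakk>
      \<Longrightarrow> Comp C W Y Z (Comp C W X Y f g) h = Comp C W X Z f (Comp C X Y Z g h)"

definition iso :: "('o, 'm, 'z) category_scheme \<Rightarrow> 'o \<Rightarrow> 'o \<Rightarrow> 'm \<Rightarrow> bool" where
  "iso C X Y f \<longleftrightarrow> f \<in> Hom C X Y \<and>
     (\<exists>g \<in> Hom C Y X. Comp C X Y X f g = Ident C X \<and> Comp C Y X Y g f = Ident C Y)"

text \<open>\<open>Pairing C Z X Y f g\<close> is \<open>\<langle>f, g\<rangle> : Z \<rightarrow> X \<times> Y\<close>.\<close>

record ('o, 'm) cartesian = "('o, 'm) category" +
  Prod :: "'o \<Rightarrow> 'o \<Rightarrow> 'o" (infixr "\<boxtimes>\<index>" 70)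
  Proj0 :: "'o \<Rightarrow> 'o \<Rightarrow> 'm"
  Proj1 :: "'o \<Rightarrow> 'o \<Rightarrow> 'm"
  Pairing :: "'o \<Rightarrow> 'o \<Rightarrow> 'o \<Rightarrow> 'm \<Rightarrow> 'm \<Rightarrow> 'm"
  One :: "'o"
  Bang :: "'o \<Rightarrow> 'm"

locale cartesian_category = category C
  for C :: "('o, 'm, 'z) cartesian_scheme" (structure) +
  assumes Prod_Ob: "\<lbrakk>X \<in> Ob C; Y \<in> Ob C\<rbrakk> \<Longrightarrow> X \<boxtimes> Y \<in> Ob C"
    and Proj0_in: "\<lbrakk>X \<in> Ob C; Y \<in> Ob C\<rbrakk> \<Longrightarrow> Proj0 C X Y \<in> Hom C (X \<boxtimes> Y) X"
    and Proj1_in: "\<lbrakk>X \<in> Ob C; Y \<in> Ob C\<rbrakk> \<Longrightarrow> Proj1 C X Y \<in> Hom C (X \<boxtimes> Y) Y"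
    and Pairing_in: "\<lbrakk>Z \<in> Ob C; X \<in> Ob C; Y \<in> Ob C; f \<in> Hom C Z X; g \<in> Hom C Z Y\<rbrakk>
      \<Longrightarrow> Pairing C Z X Y f g \<in> Hom C Z (X \<boxtimes> Y)"
    and Pairing_Proj0: "\<lbrakk>Z \<in> Ob C; X \<in> Ob C; Y \<in> Ob C; f \<in> Hom C Z X; g \<in> Hom C Z Y\<rbrakk>
      \<Longrightarrow> Comp C Z (X \<boxtimes> Y) X (Pairing C Z X Y f g) (Proj0 C X Y) = f"
    and Pairing_Proj1: "\<lbrakk>Z \<in> Ob C; X \<in> Ob C; Y \<in> Ob C; f \<in> Hom C Z X; g \<in> Hom C Z Y\<rbrakk>
      \<Longrightarrow> Comp C Z (X \<boxtimes> Y) Y (Pairing C Z X Y f g) (Proj1 C X Y) = g"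
    and Pairing_unique: "\<lbrakk>Z \<in> Ob C; X \<in> Ob C; Y \<in> Ob C; h \<in> Hom C Z (X \<boxtimes> Y)\<rbrakk>
      \<Longrightarrow> Pairing C Z X Y (Comp C Z (X \<boxtimes> Y) X h (Proj0 C X Y))
                          (Comp C Z (X \<boxtimes> Y) Y h (Proj1 C X Y)) = h"
    and One_Ob: "One C \<in> Ob C"
    and Bang_in: "X \<in> Ob C \<Longrightarrow> Bang C X \<in> Hom C X (One C)"
    and Bang_unique: "\<lbrakk>X \<in> Ob C; h \<in> Hom C X (One C)\<rbrakk> \<Longrightarrow> h = Bang C X"

text \<open>\<open>Prod_map C X X' Y Y' f g\<close> is \<open>f \<times> g : X \<times> Y \<rightarrow> X' \<times> Y'\<close> for \<open>f : X \<rightarrow> X'\<close> and \<open>g : Y \<rightarrow> Y'\<close>.\<close>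

definition Prod_map ::
  "('o, 'm, 'z) cartesian_scheme \<Rightarrow> 'o \<Rightarrow> 'o \<Rightarrow> 'o \<Rightarrow> 'o \<Rightarrow> 'm \<Rightarrow> 'm \<Rightarrow> 'm" where
  "Prod_map C X X' Y Y' f g =
     Pairing C (X \<boxtimes>\<^bsub>C\<^esub> Y) X' Y'
       (Comp C (X \<boxtimes>\<^bsub>C\<^esub> Y) X X' (Proj0 C X Y) f)
       (Comp C (X \<boxtimes>\<^bsub>C\<^esub> Y) Y Y' (Proj1 C X Y) g)"

text \<open>\<open>(X \<times> Y) \<times> Z \<rightarrow> X \<times> (Y \<times> Z)\<close>, its inverse, the swap \<open>X \<times> Y \<rightarrow> Y \<times> X\<close>, and the middle
  interchange \<open>(W \<times> X) \<times> (Y \<times> Z) \<rightarrow> (W \<times> Y) \<times> (X \<times> Z)\<close>.\<close>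

definition Cart_assoc :: "('o, 'm, 'z) cartesian_scheme \<Rightarrow> 'o \<Rightarrow> 'o \<Rightarrow> 'o \<Rightarrow> 'm" where
  "Cart_assoc C X Y Z =
     (let P = (X \<boxtimes>\<^bsub>C\<^esub> Y) \<boxtimes>\<^bsub>C\<^esub> Z; p = Proj0 C (X \<boxtimes>\<^bsub>C\<^esub> Y) Z in
      Pairing C P X (Y \<boxtimes>\<^bsub>C\<^esub> Z)
        (Comp C P (X \<boxtimes>\<^bsub>C\<^esub> Y) X p (Proj0 C X Y))
        (Pairing C P Y Z
           (Comp C P (X \<boxtimes>\<^bsub>C\<^esub> Y) Y p (Proj1 C X Y))
           (Proj1 C (X \<boxtimes>\<^bsub>C\<^esub> Y) Z)))"

definition Cart_assoc_inv :: "('o, 'm, 'z) cartesian_scheme \<Rightarrow> 'o \<Rightarrow> 'o \<Rightarrow> 'o \<Rightarrow> 'm" where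
  "Cart_assoc_inv C X Y Z =
     (let P = X \<boxtimes>\<^bsub>C\<^esub> (Y \<boxtimes>\<^bsub>C\<^esub> Z); q = Proj1 C X (Y \<boxtimes>\<^bsub>C\<^esub> Z) in
      Pairing C P (X \<boxtimes>\<^bsub>C\<^esub> Y) Z
        (Pairing C P X Y
           (Proj0 C X (Y \<boxtimes>\<^bsub>C\<^esub> Z))
           (Comp C P (Y \<boxtimes>\<^bsub>C\<^esub> Z) Y q (Proj0 C Y Z)))
        (Comp C P (Y \<boxtimes>\<^bsub>C\<^esub> Z) Z q (Proj1 C Y Z)))"

definition Cart_swap :: "('o, 'm, 'z) cartesian_scheme \<Rightarrow> 'o \<Rightarrow> 'o \<Rightarrow> 'm" where
  "Cart_swap C X Y = Pairing C (X \<boxtimes>\<^bsub>C\<^esub> Y) Y X (Proj1 C X Y) (Proj0 C X Y)"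

definition Cart_interchange :: "('o, 'm, 'z) cartesian_scheme \<Rightarrow> 'o \<Rightarrow> 'o \<Rightarrow> 'o \<Rightarrow> 'o \<Rightarrow> 'm" where
  "Cart_interchange C W X Y Z =
     Pairing C ((W \<boxtimes>\<^bsub>C\<^esub> X) \<boxtimes>\<^bsub>C\<^esub> (Y \<boxtimes>\<^bsub>C\<^esub> Z)) (W \<boxtimes>\<^bsub>C\<^esub> Y) (X \<boxtimes>\<^bsub>C\<^esub> Z)
       (Prod_map C (W \<boxtimes>\<^bsub>C\<^esub> X) W (Y \<boxtimes>\<^bsub>C\<^esub> Z) Y (Proj0 C W X) (Proj0 C Y Z))
       (Prod_map C (W \<boxtimes>\<^bsub>C\<^esub> X) X (Y \<boxtimes>\<^bsub>C\<^esub> Z) Z (Proj1 C W X) (Proj1 C Y Z))"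


section \<open>Cartesian left additive categories and reverse derivative categories\<close>

record ('o, 'm) cartesian_left_additive = "('o, 'm) cartesian" +
  Add :: "'o \<Rightarrow> 'o \<Rightarrow> 'm \<Rightarrow> 'm \<Rightarrow> 'm"
  Zero :: "'o \<Rightarrow> 'o \<Rightarrow> 'm"

definition additive ::
  "('o, 'm, 'z) cartesian_left_additive_scheme \<Rightarrow> 'o \<Rightarrow> 'o \<Rightarrow> 'm \<Rightarrow> bool" where
  "additive C X Y f \<longleftrightarrow> (\<forall>Z \<in> Ob C.
     (\<forall>x \<in> Hom C Z X. \<forall>y \<in> Hom C Z X.
        Comp C Z X Y (Add C Z X x y) f = Add C Z Y (Comp C Z X Y x f) (Comp C Z X Y y f)) \<and>
     Comp C Z X Y (Zero C Z X) f = Zero C Z Y)"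

text \<open>Additivity in the second argument, for \<open>f : X \<times> Y \<rightarrow> W\<close>.\<close>

definition additive_snd ::
  "('o, 'm, 'z) cartesian_left_additive_scheme \<Rightarrow> 'o \<Rightarrow> 'o \<Rightarrow> 'o \<Rightarrow> 'm \<Rightarrow> bool" where
  "additive_snd C X Y W f \<longleftrightarrow> (\<forall>Z \<in> Ob C. \<forall>a \<in> Hom C Z X.
     (\<forall>b \<in> Hom C Z Y. \<forall>c \<in> Hom C Z Y.
        Comp C Z (X \<boxtimes>\<^bsub>C\<^esub> Y) W (Pairing C Z X Y a (Add C Z Y b c)) f =
        Add C Z W (Comp C Z (X \<boxtimes>\<^bsub>C\<^esub> Y) W (Pairing C Z X Y a b) f)
                  (Comp C Z (X \<boxtimes>\<^bsub>C\<^esub> Y) W (Pairing C Z X Y a c) f)) \<and>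
     Comp C Z (X \<boxtimes>\<^bsub>C\<^esub> Y) W (Pairing C Z X Y a (Zero C Z Y)) f = Zero C Z W)"

locale cartesian_left_additive_category = cartesian_category C
  for C :: "('o, 'm, 'z) cartesian_left_additive_scheme" (structure) +
  assumes Add_in: "\<lbrakk>X \<in> Ob C; Y \<in> Ob C; f \<in> Hom C X Y; g \<in> Hom C X Y\<rbrakk>
      \<Longrightarrow> Add C X Y f g \<in> Hom C X Y"
    and Zero_in: "\<lbrakk>X \<in> Ob C; Y \<in> Ob C\<rbrakk> \<Longrightarrow> Zero C X Y \<in> Hom C X Y"
    and Add_assoc: "\<lbrakk>X \<in> Ob C; Y \<in> Ob C; f \<in> Hom C X Y; g \<in> Hom C X Y; h \<in> Hom C X Y\<rbrakk>
      \<Longrightarrow> Add C X Y (Add C X Y f g) h = Add C X Y f (Add C X Y g h)"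
    and Add_commute: "\<lbrakk>X \<in> Ob C; Y \<in> Ob C; f \<in> Hom C X Y; g \<in> Hom C X Y\<rbrakk>
      \<Longrightarrow> Add C X Y f g = Add C X Y g f"
    and Add_Zero: "\<lbrakk>X \<in> Ob C; Y \<in> Ob C; f \<in> Hom C X Y\<rbrakk> \<Longrightarrow> Add C X Y f (Zero C X Y) = f"
    and Comp_Add: "\<lbrakk>X \<in> Ob C; Y \<in> Ob C; Z \<in> Ob C;
        x \<in> Hom C X Y; f \<in> Hom C Y Z; g \<in> Hom C Y Z\<rbrakk>
      \<Longrightarrow> Comp C X Y Z x (Add C Y Z f g) = Add C X Z (Comp C X Y Z x f) (Comp C X Y Z x g)"
    and Comp_Zero: "\<lbrakk>X \<in> Ob C; Y \<in> Ob C; Z \<in> Ob C; x \<in> Hom C X Y\<rbrakk>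
      \<Longrightarrow> Comp C X Y Z x (Zero C Y Z) = Zero C X Z"
    and additive_Proj0: "\<lbrakk>X \<in> Ob C; Y \<in> Ob C\<rbrakk> \<Longrightarrow> additive C (X \<boxtimes> Y) X (Proj0 C X Y)"
    and additive_Proj1: "\<lbrakk>X \<in> Ob C; Y \<in> Ob C\<rbrakk> \<Longrightarrow> additive C (X \<boxtimes> Y) Y (Proj1 C X Y)"

text \<open>\<open>\<iota>\<^sub>0 = \<langle>1, 0\<rangle> : X \<rightarrow> X \<times> Y\<close> and \<open>\<iota>\<^sub>1 = \<langle>0, 1\<rangle> : Y \<rightarrow> X \<times> Y\<close>.\<close>

definition Inj0 :: "('o, 'm, 'z) cartesian_left_additive_scheme \<Rightarrow> 'o \<Rightarrow> 'o \<Rightarrow> 'm" where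
  "Inj0 C X Y = Pairing C X X Y (Ident C X) (Zero C X Y)"

definition Inj1 :: "('o, 'm, 'z) cartesian_left_additive_scheme \<Rightarrow> 'o \<Rightarrow> 'o \<Rightarrow> 'm" where
  "Inj1 C X Y = Pairing C Y X Y (Zero C Y X) (Ident C Y)"

record ('o, 'm) reverse_derivative = "('o, 'm) cartesian_left_additive" +
  Rev :: "'o \<Rightarrow> 'o \<Rightarrow> 'm \<Rightarrow> 'm"

text \<open>\<open>D[f] = (\<iota>\<^sub>0 \<times> 1) ; R[R[f]] ; \<pi>\<^sub>1 : X \<times> X \<rightarrow> Y\<close> for \<open>f : X \<rightarrow> Y\<close>.\<close>

definition Deriv :: "('o, 'm, 'z) reverse_derivative_scheme \<Rightarrow> 'o \<Rightarrow> 'o \<Rightarrow> 'm \<Rightarrow> 'm" where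
  "Deriv C X Y f =
     Comp C (X \<boxtimes>\<^bsub>C\<^esub> X) (X \<boxtimes>\<^bsub>C\<^esub> Y) Y
       (Comp C (X \<boxtimes>\<^bsub>C\<^esub> X) ((X \<boxtimes>\<^bsub>C\<^esub> Y) \<boxtimes>\<^bsub>C\<^esub> X) (X \<boxtimes>\<^bsub>C\<^esub> Y)
          (Prod_map C X (X \<boxtimes>\<^bsub>C\<^esub> Y) X X (Inj0 C X Y) (Ident C X))
          (Rev C (X \<boxtimes>\<^bsub>C\<^esub> Y) X (Rev C X Y f)))
       (Proj1 C X Y)"

text \<open>The backward part of the composite of lenses \<open>(f, f\<^sup>*) : (X, X') \<rightarrow> (Y, Y')\<close> and
  \<open>(g, g\<^sup>*) : (Y, Y') \<rightarrow> (Z, Z')\<close>; the chain rule for \<open>R\<close> has the same shape.\<close>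

definition Back_comp ::
  "('o, 'm, 'z) cartesian_scheme \<Rightarrow> 'o \<Rightarrow> 'o \<Rightarrow> 'o \<Rightarrow> 'o \<Rightarrow> 'o \<Rightarrow> 'm \<Rightarrow> 'm \<Rightarrow> 'm \<Rightarrow> 'm" where
  "Back_comp C X X' Y Y' Z' f fs gs =
     (let P = X \<boxtimes>\<^bsub>C\<^esub> Z' in
      Comp C P (X \<boxtimes>\<^bsub>C\<^esub> Y') X'
        (Pairing C P X Y' (Proj0 C X Z')
           (Comp C P (Y \<boxtimes>\<^bsub>C\<^esub> Z') Y'
              (Pairing C P Y Z' (Comp C P X Y (Proj0 C X Z') f) (Proj1 C X Z'))
              gs))
        fs)"

locale reverse_derivative_category = cartesian_left_additive_category C
  for C :: "('o, 'm, 'z) reverse_derivative_scheme" (structure) +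
  assumes Rev_in: "\<lbrakk>X \<in> Ob C; Y \<in> Ob C; f \<in> Hom C X Y\<rbrakk> \<Longrightarrow> Rev C X Y f \<in> Hom C (X \<boxtimes> Y) X"
    and Rev_Add: "\<lbrakk>X \<in> Ob C; Y \<in> Ob C; f \<in> Hom C X Y; g \<in> Hom C X Y\<rbrakk>
      \<Longrightarrow> Rev C X Y (Add C X Y f g) = Add C (X \<boxtimes> Y) X (Rev C X Y f) (Rev C X Y g)"
    and Rev_Zero: "\<lbrakk>X \<in> Ob C; Y \<in> Ob C\<rbrakk> \<Longrightarrow> Rev C X Y (Zero C X Y) = Zero C (X \<boxtimes> Y) X"
    and Rev_additive_snd: "\<lbrakk>X \<in> Ob C; Y \<in> Ob C; f \<in> Hom C X Y\<rbrakk>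
      \<Longrightarrow> additive_snd C X Y X (Rev C X Y f)"
    and Rev_Ident: "X \<in> Ob C \<Longrightarrow> Rev C X X (Ident C X) = Proj1 C X X"
    and Rev_Proj0: "\<lbrakk>X \<in> Ob C; Y \<in> Ob C\<rbrakk>
      \<Longrightarrow> Rev C (X \<boxtimes> Y) X (Proj0 C X Y) =
          Comp C ((X \<boxtimes> Y) \<boxtimes> X) X (X \<boxtimes> Y) (Proj1 C (X \<boxtimes> Y) X) (Inj0 C X Y)"
    and Rev_Proj1: "\<lbrakk>X \<in> Ob C; Y \<in> Ob C\<rbrakk>
      \<Longrightarrow> Rev C (X \<boxtimes> Y) Y (Proj1 C X Y) =
          Comp C ((X \<boxtimes> Y) \<boxtimes> Y) Y (X \<boxtimes> Y) (Proj1 C (X \<boxtimes> Y) Y) (Inj1 C X Y)"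
    and Rev_Pairing: "\<lbrakk>X \<in> Ob C; Y \<in> Ob C; Z \<in> Ob C; f \<in> Hom C X Y; g \<in> Hom C X Z\<rbrakk>
      \<Longrightarrow> Rev C X (Y \<boxtimes> Z) (Pairing C X Y Z f g) =
          Add C (X \<boxtimes> (Y \<boxtimes> Z)) X
            (Comp C (X \<boxtimes> (Y \<boxtimes> Z)) (X \<boxtimes> Y) X
               (Prod_map C X X (Y \<boxtimes> Z) Y (Ident C X) (Proj0 C Y Z)) (Rev C X Y f))
            (Comp C (X \<boxtimes> (Y \<boxtimes> Z)) (X \<boxtimes> Z) X
               (Prod_map C X X (Y \<boxtimes> Z) Z (Ident C X) (Proj1 C Y Z)) (Rev C X Z g))"
    and Rev_Bang: "X \<in> Ob C \<Longrightarrow> Rev C X (One C) (Bang C X) = Zero C (X \<boxtimes> One C) X"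
    and Rev_Comp: "\<lbrakk>X \<in> Ob C; Y \<in> Ob C; Z \<in> Ob C; f \<in> Hom C X Y; g \<in> Hom C Y Z\<rbrakk>
      \<Longrightarrow> Rev C X Z (Comp C X Y Z f g) = Back_comp C X X Y Y Z f (Rev C X Y f) (Rev C Y Z g)"
    and Deriv_Rev: "\<lbrakk>X \<in> Ob C; Y \<in> Ob C; Z \<in> Ob C; f \<in> Hom C X Y;
        a \<in> Hom C Z X; b \<in> Hom C Z Y; d \<in> Hom C Z Y\<rbrakk>
      \<Longrightarrow> Comp C Z ((X \<boxtimes> Y) \<boxtimes> (X \<boxtimes> Y)) X
            (Pairing C Z (X \<boxtimes> Y) (X \<boxtimes> Y) (Pairing C Z X Y a b) (Pairing C Z X Y (Zero C Z X) d))
            (Deriv C (X \<boxtimes> Y) X (Rev C X Y f)) =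
          Comp C Z (X \<boxtimes> Y) X (Pairing C Z X Y a d) (Rev C X Y f)"
    and Deriv_Deriv: "\<lbrakk>X \<in> Ob C; Y \<in> Ob C; Z \<in> Ob C; f \<in> Hom C X Y;
        a \<in> Hom C Z X; b \<in> Hom C Z X; c \<in> Hom C Z X; d \<in> Hom C Z X\<rbrakk>
      \<Longrightarrow> Comp C Z ((X \<boxtimes> X) \<boxtimes> (X \<boxtimes> X)) Y
            (Pairing C Z (X \<boxtimes> X) (X \<boxtimes> X) (Pairing C Z X X a b) (Pairing C Z X X c d))
            (Deriv C (X \<boxtimes> X) Y (Deriv C X Y f)) =
          Comp C Z ((X \<boxtimes> X) \<boxtimes> (X \<boxtimes> X)) Y
            (Pairing C Z (X \<boxtimes> X) (X \<boxtimes> X) (Pairing C Z X X a c) (Pairing C Z X X b d))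
            (Deriv C (X \<boxtimes> X) Y (Deriv C X Y f))"


section \<open>The coKleisli category of \<open>A \<times> -\<close>\<close>

text \<open>The comultiplication \<open>\<Delta>\<^sub>A \<times> X\<close>, as a morphism \<open>A \<times> X \<rightarrow> A \<times> (A \<times> X)\<close>.\<close>

definition Comult :: "('o, 'm, 'z) cartesian_scheme \<Rightarrow> 'o \<Rightarrow> 'o \<Rightarrow> 'm" where
  "Comult C A X =
     Comp C (A \<boxtimes>\<^bsub>C\<^esub> X) ((A \<boxtimes>\<^bsub>C\<^esub> A) \<boxtimes>\<^bsub>C\<^esub> X) (A \<boxtimes>\<^bsub>C\<^esub> (A \<boxtimes>\<^bsub>C\<^esub> X))
       (Prod_map C A (A \<boxtimes>\<^bsub>C\<^esub> A) X X (Pairing C A A A (Ident C A) (Ident C A)) (Ident C X))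
       (Cart_assoc C A A X)"

text \<open>Projections and \<open>\<langle>f, g\<rangle>\<close> are those of the finite products that \<open>CoKl(A \<times> -)\<close> inherits
  from \<open>C\<close>. In the last field, \<open>R[f] ; \<pi>\<^sub>X\<close> is precomposed with
  \<open>A \<times> (X \<times> Y) \<cong> (A \<times> X) \<times> Y\<close> so as to be a coKleisli morphism \<open>X \<times> Y \<rightarrow> X\<close>.\<close>

definition CoKl ::
  "('o, 'm) reverse_derivative \<Rightarrow> 'o \<Rightarrow> ('o, 'm) reverse_derivative" where
  "CoKl C A = \<lparr>
     Ob = Ob C,
     Hom = (\<lambda>X Y. Hom C (A \<boxtimes>\<^bsub>C\<^esub> X) Y),
     Ident = (\<lambda>X. Proj1 C A X),
     Comp = (\<lambda>X Y Z f g.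
       Comp C (A \<boxtimes>\<^bsub>C\<^esub> X) (A \<boxtimes>\<^bsub>C\<^esub> Y) Z
         (Comp C (A \<boxtimes>\<^bsub>C\<^esub> X) (A \<boxtimes>\<^bsub>C\<^esub> (A \<boxtimes>\<^bsub>C\<^esub> X)) (A \<boxtimes>\<^bsub>C\<^esub> Y)
            (Comult C A X)
            (Prod_map C A A (A \<boxtimes>\<^bsub>C\<^esub> X) Y (Ident C A) f))
         g),
     Prod = Prod C,
     Proj0 = (\<lambda>X Y. Comp C (A \<boxtimes>\<^bsub>C\<^esub> (X \<boxtimes>\<^bsub>C\<^esub> Y)) (X \<boxtimes>\<^bsub>C\<^esub> Y) X (Proj1 C A (X \<boxtimes>\<^bsub>C\<^esub> Y)) (Proj0 C X Y)),
     Proj1 = (\<lambda>X Y. Comp C (A \<boxtimes>\<^bsub>C\<^esub> (X \<boxtimes>\<^bsub>C\<^esub> Y)) (X \<boxtimes>\<^bsub>C\<^esub> Y) Y (Proj1 C A (X \<boxtimes>\<^bsub>C\<^esub> Y)) (Proj1 C X Y)),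
     Pairing = (\<lambda>Z X Y f g. Pairing C (A \<boxtimes>\<^bsub>C\<^esub> Z) X Y f g),
     One = One C,
     Bang = (\<lambda>X. Bang C (A \<boxtimes>\<^bsub>C\<^esub> X)),
     Add = (\<lambda>X Y. Add C (A \<boxtimes>\<^bsub>C\<^esub> X) Y),
     Zero = (\<lambda>X Y. Zero C (A \<boxtimes>\<^bsub>C\<^esub> X) Y),
     Rev = (\<lambda>X Y f.
       Comp C (A \<boxtimes>\<^bsub>C\<^esub> (X \<boxtimes>\<^bsub>C\<^esub> Y)) ((A \<boxtimes>\<^bsub>C\<^esub> X) \<boxtimes>\<^bsub>C\<^esub> Y) X
         (Cart_assoc_inv C A X Y)
         (Comp C ((A \<boxtimes>\<^bsub>C\<^esub> X) \<boxtimes>\<^bsub>C\<^esub> Y) (A \<boxtimes>\<^bsub>C\<^esub> X) X (Rev C (A \<boxtimes>\<^bsub>C\<^esub> X) Y f) (Proj1 C A X)))\<rparr>"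


section \<open>Symmetric monoidal structures\<close>

text \<open>\<open>Tensor M X X' Y Y' f g\<close> is \<open>f \<otimes> g : X \<otimes> Y \<rightarrow> X' \<otimes> Y'\<close> for \<open>f : X \<rightarrow> X'\<close> and \<open>g : Y \<rightarrow> Y'\<close>;
  the structural isomorphisms are \<open>(X \<otimes> Y) \<otimes> Z \<rightarrow> X \<otimes> (Y \<otimes> Z)\<close>, \<open>I \<otimes> X \<rightarrow> X\<close>, \<open>X \<otimes> I \<rightarrow> X\<close> and
  \<open>X \<otimes> Y \<rightarrow> Y \<otimes> X\<close>.\<close>

record ('o, 'm) symmetric_monoidal = "('o, 'm) category" +
  Tensor_ob :: "'o \<Rightarrow> 'o \<Rightarrow> 'o" (infixr "\<otimes>\<index>" 70)
  Tensor :: "'o \<Rightarrow> 'o \<Rightarrow> 'o \<Rightarrow> 'o \<Rightarrow> 'm \<Rightarrow> 'm \<Rightarrow> 'm"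
  Unit :: "'o"
  Associator :: "'o \<Rightarrow> 'o \<Rightarrow> 'o \<Rightarrow> 'm"
  Left_unitor :: "'o \<Rightarrow> 'm"
  Right_unitor :: "'o \<Rightarrow> 'm"
  Braiding :: "'o \<Rightarrow> 'o \<Rightarrow> 'm"

definition Cartesian_monoidal ::
  "('o, 'm, 'z) cartesian_scheme \<Rightarrow> ('o, 'm) symmetric_monoidal" where
  "Cartesian_monoidal D = \<lparr>
     Ob = Ob D, Hom = Hom D, Ident = Ident D, Comp = Comp D,
     Tensor_ob = Prod D,
     Tensor = Prod_map D,
     Unit = One D,
     Associator = Cart_assoc D,
     Left_unitor = (\<lambda>X. Proj1 D (One D) X),
     Right_unitor = (\<lambda>X. Proj0 D X (One D)),
     Braiding = Cart_swap D\<rparr>"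

text \<open>The lens \<open>(X, X') \<rightarrow> (Y, Y')\<close> given by \<open>p : X \<rightarrow> Y\<close> and an additive \<open>q : Y' \<rightarrow> X'\<close>.\<close>

definition Simple_lens ::
  "('o, 'm, 'z) cartesian_scheme \<Rightarrow> 'o \<Rightarrow> 'o \<Rightarrow> 'o \<Rightarrow> 'm \<Rightarrow> 'm \<Rightarrow> 'm \<times> 'm" where
  "Simple_lens D X X' Y' p q = (p, Comp D (X \<boxtimes>\<^bsub>D\<^esub> Y') Y' X' (Proj1 D X Y') q)"

definition Lens\<^sub>A ::
  "('o, 'm, 'z) cartesian_left_additive_scheme \<Rightarrow> ('o \<times> 'o, 'm \<times> 'm) symmetric_monoidal" where
  "Lens\<^sub>A D = \<lparr>
     Ob = Ob D \<times> Ob D,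
     Hom = (\<lambda>(X, X') (Y, Y').
       {(f, fs). f \<in> Hom D X Y \<and> fs \<in> Hom D (X \<boxtimes>\<^bsub>D\<^esub> Y') X' \<and> additive_snd D X Y' X' fs}),
     Ident = (\<lambda>(X, X'). (Ident D X, Proj1 D X X')),
     Comp = (\<lambda>(X, X') (Y, Y') (Z, Z') (f, fs) (g, gs).
       (Comp D X Y Z f g, Back_comp D X X' Y Y' Z' f fs gs)),
     Tensor_ob = (\<lambda>(X, X') (Y, Y'). (X \<boxtimes>\<^bsub>D\<^esub> Y, X' \<boxtimes>\<^bsub>D\<^esub> Y')),
     Tensor = (\<lambda>(X, X') (Y, Y') (W, W') (V, V') (f, fs) (g, gs).
       (Prod_map D X Y W V f g,
        Comp D ((X \<boxtimes>\<^bsub>D\<^esub> W) \<boxtimes>\<^bsub>D\<^esub> (Y' \<boxtimes>\<^bsub>D\<^esub> V')) ((X \<boxtimes>\<^bsub>D\<^esub> Y') \<boxtimes>\<^bsub>D\<^esub> (W \<boxtimes>\<^bsub>D\<^esub> V')) (X' \<boxtimes>\<^bsub>D\<^esub> W')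
          (Cart_interchange D X W Y' V')
          (Prod_map D (X \<boxtimes>\<^bsub>D\<^esub> Y') X' (W \<boxtimes>\<^bsub>D\<^esub> V') W' fs gs))),
     Unit = (One D, One D),
     Associator = (\<lambda>(X, X') (Y, Y') (Z, Z').
       Simple_lens D ((X \<boxtimes>\<^bsub>D\<^esub> Y) \<boxtimes>\<^bsub>D\<^esub> Z) ((X' \<boxtimes>\<^bsub>D\<^esub> Y') \<boxtimes>\<^bsub>D\<^esub> Z') (X' \<boxtimes>\<^bsub>D\<^esub> (Y' \<boxtimes>\<^bsub>D\<^esub> Z'))
         (Cart_assoc D X Y Z) (Cart_assoc_inv D X' Y' Z')),
     Left_unitor = (\<lambda>(X, X').
       Simple_lens D (One D \<boxtimes>\<^bsub>D\<^esub> X) (One D \<boxtimes>\<^bsub>D\<^esub> X') X'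
         (Proj1 D (One D) X) (Pairing D X' (One D) X' (Bang D X') (Ident D X'))),
     Right_unitor = (\<lambda>(X, X').
       Simple_lens D (X \<boxtimes>\<^bsub>D\<^esub> One D) (X' \<boxtimes>\<^bsub>D\<^esub> One D) X'
         (Proj0 D X (One D)) (Pairing D X' X' (One D) (Ident D X') (Bang D X'))),
     Braiding = (\<lambda>(X, X') (Y, Y').
       Simple_lens D (X \<boxtimes>\<^bsub>D\<^esub> Y) (X' \<boxtimes>\<^bsub>D\<^esub> Y') (Y' \<boxtimes>\<^bsub>D\<^esub> X')
         (Cart_swap D X Y) (Cart_swap D Y' X'))\<rparr>"


section \<open>Bicategories and 2-functors\<close>

text \<open>
  For 1-cells \<open>f, f' : X \<rightarrow> Y\<close> and \<open>g, g' : Y \<rightarrow> Z\<close>, the horizontal composite of \<open>\<alpha> : f \<Rightarrow> f'\<close> and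
  \<open>\<beta> : g \<Rightarrow> g'\<close> is \<open>HComp B X Y Z f f' g g' \<alpha> \<beta> : f ; g \<Rightarrow> f' ; g'\<close>. The coherence cells are
  \<open>Cell_assoc : f ; (g ; h) \<Rightarrow> (f ; g) ; h\<close>, \<open>Cell_lunit : 1 ; f \<Rightarrow> f\<close> and \<open>Cell_runit : f ; 1 \<Rightarrow> f\<close>.
\<close>

record ('o, 'f, 'c) bicategory =
  Cells0 :: "'o set"
  Cells1 :: "'o \<Rightarrow> 'o \<Rightarrow> 'f set"
  Cells2 :: "'o \<Rightarrow> 'o \<Rightarrow> 'f \<Rightarrow> 'f \<Rightarrow> 'c set"
  VIdent :: "'o \<Rightarrow> 'o \<Rightarrow> 'f \<Rightarrow> 'c"
  VComp :: "'o \<Rightarrow> 'o \<Rightarrow> 'f \<Rightarrow> 'f \<Rightarrow> 'f \<Rightarrow> 'c \<Rightarrow> 'c \<Rightarrow> 'c"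
  Ident1 :: "'o \<Rightarrow> 'f"
  Comp1 :: "'o \<Rightarrow> 'o \<Rightarrow> 'o \<Rightarrow> 'f \<Rightarrow> 'f \<Rightarrow> 'f"
  HComp :: "'o \<Rightarrow> 'o \<Rightarrow> 'o \<Rightarrow> 'f \<Rightarrow> 'f \<Rightarrow> 'f \<Rightarrow> 'f \<Rightarrow> 'c \<Rightarrow> 'c \<Rightarrow> 'c"
  Cell_assoc :: "'o \<Rightarrow> 'o \<Rightarrow> 'o \<Rightarrow> 'o \<Rightarrow> 'f \<Rightarrow> 'f \<Rightarrow> 'f \<Rightarrow> 'c"
  Cell_lunit :: "'o \<Rightarrow> 'o \<Rightarrow> 'f \<Rightarrow> 'c"
  Cell_runit :: "'o \<Rightarrow> 'o \<Rightarrow> 'f \<Rightarrow> 'c"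

definition Hom_cat :: "('o, 'f, 'c, 'z) bicategory_scheme \<Rightarrow> 'o \<Rightarrow> 'o \<Rightarrow> ('f, 'c) category" where
  "Hom_cat B X Y = \<lparr>Ob = Cells1 B X Y, Hom = Cells2 B X Y, Ident = VIdent B X Y, Comp = VComp B X Y\<rparr>"

locale bicategory =
  fixes B :: "('o, 'f, 'c, 'z) bicategory_scheme" (structure)
  assumes category_Hom_cat: "\<lbrakk>X \<in> Cells0 B; Y \<in> Cells0 B\<rbrakk> \<Longrightarrow> category (Hom_cat B X Y)"
    and Ident1_in: "X \<in> Cells0 B \<Longrightarrow> Ident1 B X \<in> Cells1 B X X"
    and Comp1_in: "\<lbrakk>X \<in> Cells0 B; Y \<in> Cells0 B; Z \<in> Cells0 B; f \<in> Cells1 B X Y; g \<in> Cells1 B Y Z\<rbrakk>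
      \<Longrightarrow> Comp1 B X Y Z f g \<in> Cells1 B X Z"
    and HComp_in: "\<lbrakk>X \<in> Cells0 B; Y \<in> Cells0 B; Z \<in> Cells0 B;
        f \<in> Cells1 B X Y; f' \<in> Cells1 B X Y; g \<in> Cells1 B Y Z; g' \<in> Cells1 B Y Z;
        \<alpha> \<in> Cells2 B X Y f f'; \<beta> \<in> Cells2 B Y Z g g'\<rbrakk>
      \<Longrightarrow> HComp B X Y Z f f' g g' \<alpha> \<beta> \<in> Cells2 B X Z (Comp1 B X Y Z f g) (Comp1 B X Y Z f' g')"
    and HComp_VIdent: "\<lbrakk>X \<in> Cells0 B; Y \<in> Cells0 B; Z \<in> Cells0 B;
        f \<in> Cells1 B X Y; g \<in> Cells1 B Y Z\<rbrakk>
      \<Longrightarrow> HComp B X Y Z f f g g (VIdent B X Y f) (VIdent B Y Z g) = VIdent B X Z (Comp1 B X Y Z f g)"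
    and HComp_VComp: "\<lbrakk>X \<in> Cells0 B; Y \<in> Cells0 B; Z \<in> Cells0 B;
        f \<in> Cells1 B X Y; f' \<in> Cells1 B X Y; f'' \<in> Cells1 B X Y;
        g \<in> Cells1 B Y Z; g' \<in> Cells1 B Y Z; g'' \<in> Cells1 B Y Z;
        \<alpha> \<in> Cells2 B X Y f f'; \<alpha>' \<in> Cells2 B X Y f' f'';
        \<beta> \<in> Cells2 B Y Z g g'; \<beta>' \<in> Cells2 B Y Z g' g''\<rbrakk>
      \<Longrightarrow> HComp B X Y Z f f'' g g'' (VComp B X Y f f' f'' \<alpha> \<alpha>') (VComp B Y Z g g' g'' \<beta> \<beta>') =
          VComp B X Z (Comp1 B X Y Z f g) (Comp1 B X Y Z f' g') (Comp1 B X Y Z f'' g'')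
            (HComp B X Y Z f f' g g' \<alpha> \<beta>) (HComp B X Y Z f' f'' g' g'' \<alpha>' \<beta>')"
    and Cell_assoc_iso: "\<lbrakk>W \<in> Cells0 B; X \<in> Cells0 B; Y \<in> Cells0 B; Z \<in> Cells0 B;
        f \<in> Cells1 B W X; g \<in> Cells1 B X Y; h \<in> Cells1 B Y Z\<rbrakk>
      \<Longrightarrow> iso (Hom_cat B W Z)
            (Comp1 B W X Z f (Comp1 B X Y Z g h)) (Comp1 B W Y Z (Comp1 B W X Y f g) h)
            (Cell_assoc B W X Y Z f g h)"
    and Cell_lunit_iso: "\<lbrakk>X \<in> Cells0 B; Y \<in> Cells0 B; f \<in> Cells1 B X Y\<rbrakk>
      \<Longrightarrow> iso (Hom_cat B X Y) (Comp1 B X X Y (Ident1 B X) f) f (Cell_lunit B X Y f)"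
    and Cell_runit_iso: "\<lbrakk>X \<in> Cells0 B; Y \<in> Cells0 B; f \<in> Cells1 B X Y\<rbrakk>
      \<Longrightarrow> iso (Hom_cat B X Y) (Comp1 B X Y Y f (Ident1 B Y)) f (Cell_runit B X Y f)"
    and Cell_assoc_natural: "\<lbrakk>W \<in> Cells0 B; X \<in> Cells0 B; Y \<in> Cells0 B; Z \<in> Cells0 B;
        f \<in> Cells1 B W X; f' \<in> Cells1 B W X; g \<in> Cells1 B X Y; g' \<in> Cells1 B X Y;
        h \<in> Cells1 B Y Z; h' \<in> Cells1 B Y Z;
        \<alpha> \<in> Cells2 B W X f f'; \<beta> \<in> Cells2 B X Y g g'; \<gamma> \<in> Cells2 B Y Z h h'\<rbrakk>
      \<Longrightarrow> VComp B W Z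
            (Comp1 B W X Z f (Comp1 B X Y Z g h))
            (Comp1 B W X Z f' (Comp1 B X Y Z g' h'))
            (Comp1 B W Y Z (Comp1 B W X Y f' g') h')
            (HComp B W X Z f f' (Comp1 B X Y Z g h) (Comp1 B X Y Z g' h')
               \<alpha> (HComp B X Y Z g g' h h' \<beta> \<gamma>))
            (Cell_assoc B W X Y Z f' g' h') =
          VComp B W Z
            (Comp1 B W X Z f (Comp1 B X Y Z g h))
            (Comp1 B W Y Z (Comp1 B W X Y f g) h)
            (Comp1 B W Y Z (Comp1 B W X Y f' g') h')
            (Cell_assoc B W X Y Z f g h)
            (HComp B W Y Z (Comp1 B W X Y f g) (Comp1 B W X Y f' g') h h'
               (HComp B W X Y f f' g g' \<alpha> \<beta>) \<gamma>)"
    and Cell_lunit_natural: "\<lbrakk>X \<in> Cells0 B; Y \<in> Cells0 B; f \<in> Cells1 B X Y; f' \<in> Cells1 B X Y;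
        \<alpha> \<in> Cells2 B X Y f f'\<rbrakk>
      \<Longrightarrow> VComp B X Y (Comp1 B X X Y (Ident1 B X) f) (Comp1 B X X Y (Ident1 B X) f') f'
            (HComp B X X Y (Ident1 B X) (Ident1 B X) f f' (VIdent B X X (Ident1 B X)) \<alpha>)
            (Cell_lunit B X Y f') =
          VComp B X Y (Comp1 B X X Y (Ident1 B X) f) f f' (Cell_lunit B X Y f) \<alpha>"
    and Cell_runit_natural: "\<lbrakk>X \<in> Cells0 B; Y \<in> Cells0 B; f \<in> Cells1 B X Y; f' \<in> Cells1 B X Y;
        \<alpha> \<in> Cells2 B X Y f f'\<rbrakk>
      \<Longrightarrow> VComp B X Y (Comp1 B X Y Y f (Ident1 B Y)) (Comp1 B X Y Y f' (Ident1 B Y)) f'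
            (HComp B X Y Y f f' (Ident1 B Y) (Ident1 B Y) \<alpha> (VIdent B Y Y (Ident1 B Y)))
            (Cell_runit B X Y f') =
          VComp B X Y (Comp1 B X Y Y f (Ident1 B Y)) f f' (Cell_runit B X Y f) \<alpha>"
    and pentagon: "\<lbrakk>V \<in> Cells0 B; W \<in> Cells0 B; X \<in> Cells0 B; Y \<in> Cells0 B; Z \<in> Cells0 B;
        f \<in> Cells1 B V W; g \<in> Cells1 B W X; h \<in> Cells1 B X Y; k \<in> Cells1 B Y Z\<rbrakk>
      \<Longrightarrow> VComp B V Z
            (Comp1 B V W Z f (Comp1 B W X Z g (Comp1 B X Y Z h k)))
            (Comp1 B V X Z (Comp1 B V W X f g) (Comp1 B X Y Z h k))
            (Comp1 B V Y Z (Comp1 B V X Y (Comp1 B V W X f g) h) k)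
            (Cell_assoc B V W X Z f g (Comp1 B X Y Z h k))
            (Cell_assoc B V X Y Z (Comp1 B V W X f g) h k) =
          VComp B V Z
            (Comp1 B V W Z f (Comp1 B W X Z g (Comp1 B X Y Z h k)))
            (Comp1 B V Y Z (Comp1 B V W Y f (Comp1 B W X Y g h)) k)
            (Comp1 B V Y Z (Comp1 B V X Y (Comp1 B V W X f g) h) k)
            (VComp B V Z
               (Comp1 B V W Z f (Comp1 B W X Z g (Comp1 B X Y Z h k)))
               (Comp1 B V W Z f (Comp1 B W Y Z (Comp1 B W X Y g h) k))
               (Comp1 B V Y Z (Comp1 B V W Y f (Comp1 B W X Y g h)) k)
               (HComp B V W Z f f
                  (Comp1 B W X Z g (Comp1 B X Y Z h k)) (Comp1 B W Y Z (Comp1 B W X Y g h) k)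
                  (VIdent B V W f) (Cell_assoc B W X Y Z g h k))
               (Cell_assoc B V W Y Z f (Comp1 B W X Y g h) k))
            (HComp B V Y Z
               (Comp1 B V W Y f (Comp1 B W X Y g h)) (Comp1 B V X Y (Comp1 B V W X f g) h) k k
               (Cell_assoc B V W X Y f g h) (VIdent B Y Z k))"
    and triangle: "\<lbrakk>X \<in> Cells0 B; Y \<in> Cells0 B; Z \<in> Cells0 B; f \<in> Cells1 B X Y; g \<in> Cells1 B Y Z\<rbrakk>
      \<Longrightarrow> VComp B X Z
            (Comp1 B X Y Z f (Comp1 B Y Y Z (Ident1 B Y) g))
            (Comp1 B X Y Z (Comp1 B X Y Y f (Ident1 B Y)) g)
            (Comp1 B X Y Z f g)
            (Cell_assoc B X Y Y Z f (Ident1 B Y) g)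
            (HComp B X Y Z (Comp1 B X Y Y f (Ident1 B Y)) f g g
               (Cell_runit B X Y f) (VIdent B Y Z g)) =
          HComp B X Y Z f f (Comp1 B Y Y Z (Ident1 B Y) g) g
            (VIdent B X Y f) (Cell_lunit B Y Z g)"

text \<open>The comparison cells are \<open>Fun_comp : F f ; F g \<Rightarrow> F (f ; g)\<close> and \<open>Fun_unit : 1 \<Rightarrow> F 1\<close>.\<close>

record ('o, 'f, 'c, 'p, 'g, 'd) bicat_map =
  Fun0 :: "'o \<Rightarrow> 'p"
  Fun1 :: "'o \<Rightarrow> 'o \<Rightarrow> 'f \<Rightarrow> 'g"
  Fun2 :: "'o \<Rightarrow> 'o \<Rightarrow> 'f \<Rightarrow> 'f \<Rightarrow> 'c \<Rightarrow> 'd"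
  Fun_comp :: "'o \<Rightarrow> 'o \<Rightarrow> 'o \<Rightarrow> 'f \<Rightarrow> 'f \<Rightarrow> 'd"
  Fun_unit :: "'o \<Rightarrow> 'd"

locale pseudofunctor = source: bicategory B + target: bicategory B'
  for B :: "('o, 'f, 'c, 'y) bicategory_scheme" and B' :: "('p, 'g, 'd, 'z) bicategory_scheme" +
  fixes F :: "('o, 'f, 'c, 'p, 'g, 'd) bicat_map"
  assumes Fun0_in: "X \<in> Cells0 B \<Longrightarrow> Fun0 F X \<in> Cells0 B'"
    and Fun1_in: "\<lbrakk>X \<in> Cells0 B; Y \<in> Cells0 B; f \<in> Cells1 B X Y\<rbrakk>
      \<Longrightarrow> Fun1 F X Y f \<in> Cells1 B' (Fun0 F X) (Fun0 F Y)"
    and Fun2_in: "\<lbrakk>X \<in> Cells0 B; Y \<in> Cells0 B; f \<in> Cells1 B X Y; f' \<in> Cells1 B X Y;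
        \<alpha> \<in> Cells2 B X Y f f'\<rbrakk>
      \<Longrightarrow> Fun2 F X Y f f' \<alpha> \<in> Cells2 B' (Fun0 F X) (Fun0 F Y) (Fun1 F X Y f) (Fun1 F X Y f')"
    and Fun2_VIdent: "\<lbrakk>X \<in> Cells0 B; Y \<in> Cells0 B; f \<in> Cells1 B X Y\<rbrakk>
      \<Longrightarrow> Fun2 F X Y f f (VIdent B X Y f) = VIdent B' (Fun0 F X) (Fun0 F Y) (Fun1 F X Y f)"
    and Fun2_VComp: "\<lbrakk>X \<in> Cells0 B; Y \<in> Cells0 B;
        f \<in> Cells1 B X Y; f' \<in> Cells1 B X Y; f'' \<in> Cells1 B X Y;
        \<alpha> \<in> Cells2 B X Y f f'; \<beta> \<in> Cells2 B X Y f' f''\<rbrakk>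
      \<Longrightarrow> Fun2 F X Y f f'' (VComp B X Y f f' f'' \<alpha> \<beta>) =
          VComp B' (Fun0 F X) (Fun0 F Y) (Fun1 F X Y f) (Fun1 F X Y f') (Fun1 F X Y f'')
            (Fun2 F X Y f f' \<alpha>) (Fun2 F X Y f' f'' \<beta>)"
    and Fun_comp_iso: "\<lbrakk>X \<in> Cells0 B; Y \<in> Cells0 B; Z \<in> Cells0 B;
        f \<in> Cells1 B X Y; g \<in> Cells1 B Y Z\<rbrakk>
      \<Longrightarrow> iso (Hom_cat B' (Fun0 F X) (Fun0 F Z))
            (Comp1 B' (Fun0 F X) (Fun0 F Y) (Fun0 F Z) (Fun1 F X Y f) (Fun1 F Y Z g))
            (Fun1 F X Z (Comp1 B X Y Z f g))
            (Fun_comp F X Y Z f g)"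
    and Fun_unit_iso: "X \<in> Cells0 B
      \<Longrightarrow> iso (Hom_cat B' (Fun0 F X) (Fun0 F X))
            (Ident1 B' (Fun0 F X)) (Fun1 F X X (Ident1 B X)) (Fun_unit F X)"
    and Fun_comp_natural: "\<lbrakk>X \<in> Cells0 B; Y \<in> Cells0 B; Z \<in> Cells0 B;
        f \<in> Cells1 B X Y; f' \<in> Cells1 B X Y; g \<in> Cells1 B Y Z; g' \<in> Cells1 B Y Z;
        \<alpha> \<in> Cells2 B X Y f f'; \<beta> \<in> Cells2 B Y Z g g'\<rbrakk>
      \<Longrightarrow> VComp B' (Fun0 F X) (Fun0 F Z)
            (Comp1 B' (Fun0 F X) (Fun0 F Y) (Fun0 F Z) (Fun1 F X Y f) (Fun1 F Y Z g))
            (Comp1 B' (Fun0 F X) (Fun0 F Y) (Fun0 F Z) (Fun1 F X Y f') (Fun1 F Y Z g'))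
            (Fun1 F X Z (Comp1 B X Y Z f' g'))
            (HComp B' (Fun0 F X) (Fun0 F Y) (Fun0 F Z)
               (Fun1 F X Y f) (Fun1 F X Y f') (Fun1 F Y Z g) (Fun1 F Y Z g')
               (Fun2 F X Y f f' \<alpha>) (Fun2 F Y Z g g' \<beta>))
            (Fun_comp F X Y Z f' g') =
          VComp B' (Fun0 F X) (Fun0 F Z)
            (Comp1 B' (Fun0 F X) (Fun0 F Y) (Fun0 F Z) (Fun1 F X Y f) (Fun1 F Y Z g))
            (Fun1 F X Z (Comp1 B X Y Z f g))
            (Fun1 F X Z (Comp1 B X Y Z f' g'))
            (Fun_comp F X Y Z f g)
            (Fun2 F X Z (Comp1 B X Y Z f g) (Comp1 B X Y Z f' g') (HComp B X Y Z f f' g g' \<alpha> \<beta>))"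
    and Fun_assoc: "\<lbrakk>W \<in> Cells0 B; X \<in> Cells0 B; Y \<in> Cells0 B; Z \<in> Cells0 B;
        f \<in> Cells1 B W X; g \<in> Cells1 B X Y; h \<in> Cells1 B Y Z\<rbrakk>
      \<Longrightarrow> (let W' = Fun0 F W; X' = Fun0 F X; Y' = Fun0 F Y; Z' = Fun0 F Z;
              Ff = Fun1 F W X f; Fg = Fun1 F X Y g; Fh = Fun1 F Y Z h;
              fg = Comp1 B W X Y f g; gh = Comp1 B X Y Z g h;
              s = Comp1 B' W' X' Z' Ff (Comp1 B' X' Y' Z' Fg Fh);
              t = Fun1 F W Z (Comp1 B W Y Z fg h)
           in VComp B' W' Z' s (Fun1 F W Z (Comp1 B W X Z f gh)) t
                (VComp B' W' Z' s (Comp1 B' W' X' Z' Ff (Fun1 F X Z gh))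
                   (Fun1 F W Z (Comp1 B W X Z f gh))
                   (HComp B' W' X' Z' Ff Ff (Comp1 B' X' Y' Z' Fg Fh) (Fun1 F X Z gh)
                      (VIdent B' W' X' Ff) (Fun_comp F X Y Z g h))
                   (Fun_comp F W X Z f gh))
                (Fun2 F W Z (Comp1 B W X Z f gh) (Comp1 B W Y Z fg h) (Cell_assoc B W X Y Z f g h)) =
              VComp B' W' Z' s (Comp1 B' W' Y' Z' (Fun1 F W Y fg) Fh) t
                (VComp B' W' Z' s (Comp1 B' W' Y' Z' (Comp1 B' W' X' Y' Ff Fg) Fh)
                   (Comp1 B' W' Y' Z' (Fun1 F W Y fg) Fh)
                   (Cell_assoc B' W' X' Y' Z' Ff Fg Fh)
                   (HComp B' W' Y' Z' (Comp1 B' W' X' Y' Ff Fg) (Fun1 F W Y fg) Fh Fh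
                      (Fun_comp F W X Y f g) (VIdent B' Y' Z' Fh)))
                (Fun_comp F W Y Z fg h))"
    and Fun_lunit: "\<lbrakk>X \<in> Cells0 B; Y \<in> Cells0 B; f \<in> Cells1 B X Y\<rbrakk>
      \<Longrightarrow> (let X' = Fun0 F X; Y' = Fun0 F Y; Ff = Fun1 F X Y f; i = Ident1 B X; Fi = Fun1 F X X i;
              s = Comp1 B' X' X' Y' (Ident1 B' X') Ff; m = Fun1 F X Y (Comp1 B X X Y i f)
           in VComp B' X' Y' s m Ff
                (VComp B' X' Y' s (Comp1 B' X' X' Y' Fi Ff) m
                   (HComp B' X' X' Y' (Ident1 B' X') Fi Ff Ff (Fun_unit F X) (VIdent B' X' Y' Ff))
                   (Fun_comp F X X Y i f))
                (Fun2 F X Y (Comp1 B X X Y i f) f (Cell_lunit B X Y f)) =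
              Cell_lunit B' X' Y' Ff)"
    and Fun_runit: "\<lbrakk>X \<in> Cells0 B; Y \<in> Cells0 B; f \<in> Cells1 B X Y\<rbrakk>
      \<Longrightarrow> (let X' = Fun0 F X; Y' = Fun0 F Y; Ff = Fun1 F X Y f; i = Ident1 B Y; Fi = Fun1 F Y Y i;
              s = Comp1 B' X' Y' Y' Ff (Ident1 B' Y'); m = Fun1 F X Y (Comp1 B X Y Y f i)
           in VComp B' X' Y' s m Ff
                (VComp B' X' Y' s (Comp1 B' X' Y' Y' Ff Fi) m
                   (HComp B' X' Y' Y' Ff Ff (Ident1 B' Y') Fi (VIdent B' X' Y' Ff) (Fun_unit F Y))
                   (Fun_comp F X Y Y f i))
                (Fun2 F X Y (Comp1 B X Y Y f i) f (Cell_runit B X Y f)) =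
              Cell_runit B' X' Y' Ff)"


section \<open>The bicategory \<open>Para(M)\<close>\<close>

text \<open>The composite of \<open>(P, f)\<close> and \<open>(Q, g)\<close> has parameter object \<open>Q \<otimes> P\<close>, so the coherence cell
  \<open>f ; (g ; h) \<Rightarrow> (f ; g) ; h\<close> is the associator \<open>(S \<otimes> Q) \<otimes> P \<rightarrow> S \<otimes> (Q \<otimes> P)\<close>, horizontal
  composition reverses the order of tensor factors, and left unit cells are right unitors
  and conversely. The braiding is not used.\<close>

definition Para :: "('o, 'm) symmetric_monoidal \<Rightarrow> ('o, 'o \<times> 'm, 'm) bicategory" where
  "Para M = \<lparr>
     Cells0 = Ob M,
     Cells1 = (\<lambda>X Y. {(P, f). P \<in> Ob M \<and> f \<in> Hom M (P \<otimes>\<^bsub>M\<^esub> X) Y}),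
     Cells2 = (\<lambda>X Y (P', f') (P, f).
       {r \<in> Hom M P' P.
          Comp M (P' \<otimes>\<^bsub>M\<^esub> X) (P \<otimes>\<^bsub>M\<^esub> X) Y (Tensor M P' P X X r (Ident M X)) f = f'}),
     VIdent = (\<lambda>X Y (P, f). Ident M P),
     VComp = (\<lambda>X Y (P'', f'') (P', f') (P, f) r s. Comp M P'' P' P r s),
     Ident1 = (\<lambda>X. (Unit M, Left_unitor M X)),
     Comp1 = (\<lambda>X Y Z (P, f) (Q, g).
       (Q \<otimes>\<^bsub>M\<^esub> P,
        Comp M ((Q \<otimes>\<^bsub>M\<^esub> P) \<otimes>\<^bsub>M\<^esub> X) (Q \<otimes>\<^bsub>M\<^esub> Y) Z
          (Comp M ((Q \<otimes>\<^bsub>M\<^esub> P) \<otimes>\<^bsub>M\<^esub> X) (Q \<otimes>\<^bsub>M\<^esub> (P \<otimes>\<^bsub>M\<^esub> X)) (Q \<otimes>\<^bsub>M\<^esub> Y)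
             (Associator M Q P X)
             (Tensor M Q Q (P \<otimes>\<^bsub>M\<^esub> X) Y (Ident M Q) f))
          g)),
     HComp = (\<lambda>X Y Z (P', f') (P, f) (Q', g') (Q, g) r s. Tensor M Q' Q P' P s r),
     Cell_assoc = (\<lambda>W X Y Z (P, f) (Q, g) (S, h). Associator M S Q P),
     Cell_lunit = (\<lambda>X Y (P, f). Right_unitor M P),
     Cell_runit = (\<lambda>X Y (P, f). Left_unitor M P)\<rparr>"


section \<open>The monoidal product of coKleisli morphisms, explicitly\<close>

context cartesian_category
begin

lemma Prod_map_in:
  assumes "X \<in> Ob C" "X' \<in> Ob C" "Y \<in> Ob C" "Y' \<in> Ob C" "f \<in> Hom C X X'" "g \<in> Hom C Y Y'"
  shows "Prod_map C X X' Y Y' f g \<in> Hom C (X \<boxtimes> Y) (X' \<boxtimes> Y')"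
  unfolding Prod_map_def
  using assms by (intro Pairing_in Prod_Ob Comp_in[of _ X] Comp_in[of _ Y] Proj0_in Proj1_in)

lemma Comp_Pairing:
  assumes o: "W \<in> Ob C" "Z \<in> Ob C" "X \<in> Ob C" "Y \<in> Ob C"
    and m: "h \<in> Hom C W Z" "f \<in> Hom C Z X" "g \<in> Hom C Z Y"
  shows "Comp C W Z (X \<boxtimes> Y) h (Pairing C Z X Y f g) =
    Pairing C W X Y (Comp C W Z X h f) (Comp C W Z Y h g)"
proof -
  let ?p = "Pairing C Z X Y f g"
  have p: "?p \<in> Hom C Z (X \<boxtimes> Y)" using o m by (intro Pairing_in)
  have hp: "Comp C W Z (X \<boxtimes> Y) h ?p \<in> Hom C W (X \<boxtimes> Y)"
    using o m p by (intro Comp_in[of _ Z] Prod_Ob)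
  have "Comp C W (X \<boxtimes> Y) X (Comp C W Z (X \<boxtimes> Y) h ?p) (Proj0 C X Y) = Comp C W Z X h f"
    using o m p by (simp add: Comp_assoc Prod_Ob Proj0_in Pairing_Proj0)
  moreover have "Comp C W (X \<boxtimes> Y) Y (Comp C W Z (X \<boxtimes> Y) h ?p) (Proj1 C X Y) = Comp C W Z Y h g"
    using o m p by (simp add: Comp_assoc Prod_Ob Proj1_in Pairing_Proj1)
  ultimately show ?thesis using Pairing_unique[OF o(1,3,4) hp] by simp
qed

lemma Pairing_Prod_map:
  assumes o: "W \<in> Ob C" "X \<in> Ob C" "X' \<in> Ob C" "Y \<in> Ob C" "Y' \<in> Ob C"
    and m: "a \<in> Hom C W X" "b \<in> Hom C W Y" "f \<in> Hom C X X'" "g \<in> Hom C Y Y'"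
  shows "Comp C W (X \<boxtimes> Y) (X' \<boxtimes> Y') (Pairing C W X Y a b) (Prod_map C X X' Y Y' f g) =
    Pairing C W X' Y' (Comp C W X X' a f) (Comp C W Y Y' b g)"
proof -
  have p: "Pairing C W X Y a b \<in> Hom C W (X \<boxtimes> Y)" using o m by (intro Pairing_in)
  have ob: "X \<boxtimes> Y \<in> Ob C" using o by (intro Prod_Ob)
  have q: "Comp C (X \<boxtimes> Y) X X' (Proj0 C X Y) f \<in> Hom C (X \<boxtimes> Y) X'"
    "Comp C (X \<boxtimes> Y) Y Y' (Proj1 C X Y) g \<in> Hom C (X \<boxtimes> Y) Y'"
    using o m ob by (auto intro: Comp_in[of _ X] Comp_in[of _ Y] Proj0_in Proj1_in)
  show ?thesis
    unfolding Prod_map_def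
    using o m p ob q
    by (simp add: Comp_Pairing Proj0_in Proj1_in Pairing_Proj0 Pairing_Proj1 flip: Comp_assoc)
qed

lemma Pairing_interchange:
  assumes o: "Z \<in> Ob C" "S \<in> Ob C" "T \<in> Ob C" "U \<in> Ob C" "V \<in> Ob C"
    and m: "a \<in> Hom C Z (S \<boxtimes> T)" "b \<in> Hom C Z (U \<boxtimes> V)"
  shows "Comp C Z ((S \<boxtimes> T) \<boxtimes> (U \<boxtimes> V)) ((S \<boxtimes> U) \<boxtimes> (T \<boxtimes> V))
      (Pairing C Z (S \<boxtimes> T) (U \<boxtimes> V) a b) (Cart_interchange C S T U V) =
    Pairing C Z (S \<boxtimes> U) (T \<boxtimes> V)
      (Pairing C Z S U (Comp C Z (S \<boxtimes> T) S a (Proj0 C S T)) (Comp C Z (U \<boxtimes> V) U b (Proj0 C U V)))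
      (Pairing C Z T V (Comp C Z (S \<boxtimes> T) T a (Proj1 C S T)) (Comp C Z (U \<boxtimes> V) V b (Proj1 C U V)))"
proof -
  have ob: "S \<boxtimes> T \<in> Ob C" "U \<boxtimes> V \<in> Ob C" "S \<boxtimes> U \<in> Ob C" "T \<boxtimes> V \<in> Ob C"
    "(S \<boxtimes> T) \<boxtimes> (U \<boxtimes> V) \<in> Ob C"
    using o by (auto intro: Prod_Ob)
  have p: "Pairing C Z (S \<boxtimes> T) (U \<boxtimes> V) a b \<in> Hom C Z ((S \<boxtimes> T) \<boxtimes> (U \<boxtimes> V))"
    using o m ob by (intro Pairing_in)
  have q: "Prod_map C (S \<boxtimes> T) S (U \<boxtimes> V) U (Proj0 C S T) (Proj0 C U V) \<in> Hom C ((S \<boxtimes> T) \<boxtimes> (U \<boxtimes> V)) (S \<boxtimes> U)"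
    "Prod_map C (S \<boxtimes> T) T (U \<boxtimes> V) V (Proj1 C S T) (Proj1 C U V) \<in> Hom C ((S \<boxtimes> T) \<boxtimes> (U \<boxtimes> V)) (T \<boxtimes> V)"
    using o ob by (auto intro!: Prod_map_in Proj0_in Proj1_in)
  show ?thesis
    unfolding Cart_interchange_def using o m ob p q
    by (simp add: Comp_Pairing Pairing_Prod_map Proj0_in Proj1_in)
qed

lemma Comult_eq:
  assumes o: "A \<in> Ob C" "X \<in> Ob C"
  shows "Comult C A X = Pairing C (A \<boxtimes> X) A (A \<boxtimes> X) (Proj0 C A X) (Ident C (A \<boxtimes> X))"
proof -
  let ?d = "Pairing C A A A (Ident C A) (Ident C A)"
  let ?e = "Prod_map C A (A \<boxtimes> A) X X ?d (Ident C X)"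
  have d: "?d \<in> Hom C A (A \<boxtimes> A)" using o by (intro Pairing_in Ident_in)
  have ob: "A \<boxtimes> X \<in> Ob C" "A \<boxtimes> A \<in> Ob C" "(A \<boxtimes> A) \<boxtimes> X \<in> Ob C"
    using o by (auto intro: Prod_Ob)
  have e: "?e \<in> Hom C (A \<boxtimes> X) ((A \<boxtimes> A) \<boxtimes> X)" using o d ob by (intro Prod_map_in Ident_in)
  have pd: "Comp C (A \<boxtimes> X) A (A \<boxtimes> A) (Proj0 C A X) ?d \<in> Hom C (A \<boxtimes> X) (A \<boxtimes> A)"
    using o d ob by (intro Comp_in[of _ A] Proj0_in)
  have e0: "Comp C (A \<boxtimes> X) ((A \<boxtimes> A) \<boxtimes> X) (A \<boxtimes> A) ?e (Proj0 C (A \<boxtimes> A) X)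
      = Comp C (A \<boxtimes> X) A (A \<boxtimes> A) (Proj0 C A X) ?d"
    and e1: "Comp C (A \<boxtimes> X) ((A \<boxtimes> A) \<boxtimes> X) X ?e (Proj1 C (A \<boxtimes> A) X) = Proj1 C A X"
    unfolding Prod_map_def using o d ob pd
    by (simp_all add: Pairing_Proj0 Pairing_Proj1 Comp_Ident Proj1_in Comp_in)
  have i: "Pairing C (A \<boxtimes> X) A X (Proj0 C A X) (Proj1 C A X) = Ident C (A \<boxtimes> X)"
    using Pairing_unique[of "A \<boxtimes> X" A X "Ident C (A \<boxtimes> X)"] o ob
    by (simp add: Ident_Comp Ident_in Proj0_in Proj1_in)
  let ?E = "(A \<boxtimes> A) \<boxtimes> X"
  have x: "Comp C ?E (A \<boxtimes> A) A (Proj0 C (A \<boxtimes> A) X) p \<in> Hom C ?E A" if "p \<in> Hom C (A \<boxtimes> A) A" for p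
    using that o ob by (intro Comp_in Proj0_in)
  have y: "Comp C (A \<boxtimes> X) ?E A ?e (Comp C ?E (A \<boxtimes> A) A (Proj0 C (A \<boxtimes> A) X) p)
      = Comp C (A \<boxtimes> X) A A (Proj0 C A X) (Comp C A (A \<boxtimes> A) A ?d p)"
    if "p \<in> Hom C (A \<boxtimes> A) A" for p
  proof -
    have "Comp C (A \<boxtimes> X) ?E A ?e (Comp C ?E (A \<boxtimes> A) A (Proj0 C (A \<boxtimes> A) X) p)
      = Comp C (A \<boxtimes> X) (A \<boxtimes> A) A (Comp C (A \<boxtimes> X) ?E (A \<boxtimes> A) ?e (Proj0 C (A \<boxtimes> A) X)) p"
      using that o ob e by (simp add: Comp_assoc Proj0_in)
    then show ?thesis using that o ob d by (simp add: e0 Comp_assoc Proj0_in)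
  qed
  have z: "Pairing C ?E A X (Comp C ?E (A \<boxtimes> A) A (Proj0 C (A \<boxtimes> A) X) (Proj1 C A A)) (Proj1 C (A \<boxtimes> A) X)
      \<in> Hom C ?E (A \<boxtimes> X)"
    using o ob by (intro Pairing_in x Proj1_in)
  show ?thesis
    unfolding Comult_def Cart_assoc_def Let_def
    apply (subst Comp_Pairing)
    using o ob e x z apply (auto intro: Proj0_in Proj1_in)[7]
    apply (subst Comp_Pairing)
    using o ob e x z apply (auto intro: Proj0_in Proj1_in)[7]
    using o ob d
    by (simp add: y e1 i Proj0_in Proj1_in Pairing_Proj0 Pairing_Proj1 Ident_in Comp_Ident)
qed

end

text \<open>For \<open>f : A \<times> X \<rightarrow> Y\<close> and \<open>g : A \<times> X' \<rightarrow> Y'\<close>, the tensor of \<open>f\<close> and \<open>g\<close> in the cartesian monoidal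
  category \<open>CoKl(A \<times> -)\<close> is
  \<open>A \<times> (X \<times> X') \<rightarrow> (A \<times> A) \<times> (X \<times> X') \<cong> (A \<times> X) \<times> (A \<times> X') \<rightarrow> Y \<times> Y'\<close>,
  by the diagonal of \<open>A\<close>, the middle interchange and \<open>f \<times> g\<close>.\<close>

lemma Tensor_CoKl:
  fixes C :: "('o, 'm) reverse_derivative"
  assumes C: "cartesian_category C"
    and o: "A \<in> Ob C" "X \<in> Ob C" "Y \<in> Ob C" "X' \<in> Ob C" "Y' \<in> Ob C"
    and m: "f \<in> Hom (CoKl C A) X Y" "g \<in> Hom (CoKl C A) X' Y'"
  shows "Tensor (Cartesian_monoidal (CoKl C A)) X Y X' Y' f g =
    Comp C (A \<boxtimes>\<^bsub>C\<^esub> (X \<boxtimes>\<^bsub>C\<^esub> X')) ((A \<boxtimes>\<^bsub>C\<^esub> X) \<boxtimes>\<^bsub>C\<^esub> (A \<boxtimes>\<^bsub>C\<^esub> X')) (Y \<boxtimes>\<^bsub>C\<^esub> Y')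
      (Comp C (A \<boxtimes>\<^bsub>C\<^esub> (X \<boxtimes>\<^bsub>C\<^esub> X')) ((A \<boxtimes>\<^bsub>C\<^esub> A) \<boxtimes>\<^bsub>C\<^esub> (X \<boxtimes>\<^bsub>C\<^esub> X')) ((A \<boxtimes>\<^bsub>C\<^esub> X) \<boxtimes>\<^bsub>C\<^esub> (A \<boxtimes>\<^bsub>C\<^esub> X'))
        (Prod_map C A (A \<boxtimes>\<^bsub>C\<^esub> A) (X \<boxtimes>\<^bsub>C\<^esub> X') (X \<boxtimes>\<^bsub>C\<^esub> X')
          (Pairing C A A A (Ident C A) (Ident C A)) (Ident C (X \<boxtimes>\<^bsub>C\<^esub> X')))
        (Cart_interchange C A A X X'))
      (Prod_map C (A \<boxtimes>\<^bsub>C\<^esub> X) Y (A \<boxtimes>\<^bsub>C\<^esub> X') Y' f g)"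
proof -
  interpret cartesian_category C by (fact C)
  let ?X = "X \<boxtimes>\<^bsub>C\<^esub> X'" let ?W = "A \<boxtimes>\<^bsub>C\<^esub> (X \<boxtimes>\<^bsub>C\<^esub> X')"
  have f: "f \<in> Hom C (A \<boxtimes>\<^bsub>C\<^esub> X) Y" and g: "g \<in> Hom C (A \<boxtimes>\<^bsub>C\<^esub> X') Y'"
    using m by (simp_all add: CoKl_def)
  have ob: "?X \<in> Ob C" "?W \<in> Ob C" "A \<boxtimes>\<^bsub>C\<^esub> X \<in> Ob C" "A \<boxtimes>\<^bsub>C\<^esub> X' \<in> Ob C" "A \<boxtimes>\<^bsub>C\<^esub> A \<in> Ob C"
    using o by (auto intro: Prod_Ob)
  have p: "Proj0 C A ?X \<in> Hom C ?W A" "Proj1 C A ?X \<in> Hom C ?W ?X"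
    using o ob by (auto intro: Proj0_in Proj1_in)
  have cc: "Comp (CoKl C A) ?X Z V u k = Comp C ?W (A \<boxtimes>\<^bsub>C\<^esub> Z) V (Pairing C ?W A Z (Proj0 C A ?X) u) k"
    if "Z \<in> Ob C" "u \<in> Hom C ?W Z" for Z V u k
    using that o ob p
    by (simp add: CoKl_def Comult_eq Pairing_Prod_map Ident_in Ident_Comp Comp_Ident)
  have q: "Comp C ?W ?X X (Proj1 C A ?X) (Proj0 C X X') \<in> Hom C ?W X"
     "Comp C ?W ?X X' (Proj1 C A ?X) (Proj1 C X X') \<in> Hom C ?W X'"
    using o ob p by (auto intro!: Comp_in[of _ ?X] Proj0_in Proj1_in)
  have "Tensor (Cartesian_monoidal (CoKl C A)) X Y X' Y' f g =
    Pairing C ?W Y Y'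
      (Comp (CoKl C A) ?X X Y (Comp C ?W ?X X (Proj1 C A ?X) (Proj0 C X X')) f)
      (Comp (CoKl C A) ?X X' Y' (Comp C ?W ?X X' (Proj1 C A ?X) (Proj1 C X X')) g)"
    by (simp add: Cartesian_monoidal_def Prod_map_def CoKl_def)
  also have "\<dots> = Pairing C ?W Y Y'
      (Comp C ?W (A \<boxtimes>\<^bsub>C\<^esub> X) Y
        (Pairing C ?W A X (Proj0 C A ?X) (Comp C ?W ?X X (Proj1 C A ?X) (Proj0 C X X'))) f)
      (Comp C ?W (A \<boxtimes>\<^bsub>C\<^esub> X') Y'
        (Pairing C ?W A X' (Proj0 C A ?X) (Comp C ?W ?X X' (Proj1 C A ?X) (Proj1 C X X'))) g)"
    using o q by (simp add: cc)
  also have "\<dots> = Comp C ?W ((A \<boxtimes>\<^bsub>C\<^esub> X) \<boxtimes>\<^bsub>C\<^esub> (A \<boxtimes>\<^bsub>C\<^esub> X')) (Y \<boxtimes>\<^bsub>C\<^esub> Y')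
      (Pairing C ?W (A \<boxtimes>\<^bsub>C\<^esub> X) (A \<boxtimes>\<^bsub>C\<^esub> X')
        (Pairing C ?W A X (Proj0 C A ?X) (Comp C ?W ?X X (Proj1 C A ?X) (Proj0 C X X')))
        (Pairing C ?W A X' (Proj0 C A ?X) (Comp C ?W ?X X' (Proj1 C A ?X) (Proj1 C X X'))))
      (Prod_map C (A \<boxtimes>\<^bsub>C\<^esub> X) Y (A \<boxtimes>\<^bsub>C\<^esub> X') Y' f g)"
    using o ob p q f g by (simp add: Pairing_Prod_map Pairing_in)
  finally have lhs: "Tensor (Cartesian_monoidal (CoKl C A)) X Y X' Y' f g = \<dots>" .
  let ?d = "Pairing C A A A (Ident C A) (Ident C A)"
  have d: "?d \<in> Hom C A (A \<boxtimes>\<^bsub>C\<^esub> A)" using o by (intro Pairing_in Ident_in)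
  let ?a = "Comp C ?W A (A \<boxtimes>\<^bsub>C\<^esub> A) (Proj0 C A ?X) ?d"
  have a: "?a \<in> Hom C ?W (A \<boxtimes>\<^bsub>C\<^esub> A)" using o ob p d by (intro Comp_in[of _ A])
  have aq: "Comp C ?W (A \<boxtimes>\<^bsub>C\<^esub> A) A ?a (Proj0 C A A) = Proj0 C A ?X"
    "Comp C ?W (A \<boxtimes>\<^bsub>C\<^esub> A) A ?a (Proj1 C A A) = Proj0 C A ?X"
    using o ob p d
    by (simp_all add: Comp_assoc Proj0_in Proj1_in Pairing_Proj0 Pairing_Proj1 Ident_in Comp_Ident)
  have e: "Prod_map C A (A \<boxtimes>\<^bsub>C\<^esub> A) ?X ?X ?d (Ident C ?X) = Pairing C ?W (A \<boxtimes>\<^bsub>C\<^esub> A) ?X ?a (Proj1 C A ?X)"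
    unfolding Prod_map_def using o ob p by (simp add: Comp_Ident)
  have e': "Pairing C ?W (A \<boxtimes>\<^bsub>C\<^esub> A) ?X ?a (Proj1 C A ?X) \<in> Hom C ?W ((A \<boxtimes>\<^bsub>C\<^esub> A) \<boxtimes>\<^bsub>C\<^esub> ?X)"
    using o ob p a by (intro Pairing_in)
  have "Comp C ?W ((A \<boxtimes>\<^bsub>C\<^esub> A) \<boxtimes>\<^bsub>C\<^esub> ?X) ((A \<boxtimes>\<^bsub>C\<^esub> X) \<boxtimes>\<^bsub>C\<^esub> (A \<boxtimes>\<^bsub>C\<^esub> X'))
      (Pairing C ?W (A \<boxtimes>\<^bsub>C\<^esub> A) ?X ?a (Proj1 C A ?X)) (Cart_interchange C A A X X') =
    Pairing C ?W (A \<boxtimes>\<^bsub>C\<^esub> X) (A \<boxtimes>\<^bsub>C\<^esub> X')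
        (Pairing C ?W A X (Proj0 C A ?X) (Comp C ?W ?X X (Proj1 C A ?X) (Proj0 C X X')))
        (Pairing C ?W A X' (Proj0 C A ?X) (Comp C ?W ?X X' (Proj1 C A ?X) (Proj1 C X X')))"
    using o ob p a by (subst Pairing_interchange) (simp_all only: aq)
  then show ?thesis unfolding lhs by (simp add: e)
qed

end

theory Submission
  imports Defs
begin

text \<open>
  \<open>Para\<close> is functorial: a strict monoidal functor \<open>M \<rightarrow> N\<close> induces a pseudofunctor
  \<open>Para(M) \<rightarrow> Para(N)\<close> whose comparison cells are identities. So it suffices that
  \<open>f \<mapsto> (f, R[f])\<close> is a strict monoidal functor from \<open>D = CoKl(A \<times> -)\<close> to \<open>Lens\<^sub>A(D)\<close>.
  Functoriality is the chain rule; strictness amounts to \<open>R[f \<times> g]\<close> being \<open>R[f] \<times> R[g]\<close> up to the middle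
  interchange, and to the reverse derivative of a structural isomorphism being its inverse in the
  second argument, both of which follow from the rules for pairings and projections.
  All equations between morphisms of a cartesian category are checked by evaluating both sides on
  generalized elements, where elements of a product are replaced by pairs.
\<close>

section \<open>Evaluation on generalized elements\<close>

context category
begin

text \<open>Oriented so that \<open>simp\<close> pushes a generalized element into a composite.\<close>

lemma Comp_Comp:
  "\<lbrakk>W \<in> Ob C; X \<in> Ob C; Y \<in> Ob C; Z \<in> Ob C; f \<in> Hom C W X; g \<in> Hom C X Y; h \<in> Hom C Y Z\<rbrakk>
    \<Longrightarrow> Comp C W X Z f (Comp C X Y Z g h) = Comp C W Y Z (Comp C W X Y f g) h"
  by (simp add: Comp_assoc)

text \<open>The element \<open>Ident C X\<close> at stage \<open>X\<close> recovers the morphism, as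
  in the Yoneda lemma. The elements are bound by an object-level quantifier so that
  \<open>ball_Pairing\<close> can rewrite it.\<close>

lemma hom_eqI:
  assumes "X \<in> Ob C" "Y \<in> Ob C" "f \<in> Hom C X Y" "g \<in> Hom C X Y"
    and "\<And>Z. Z \<in> Ob C \<Longrightarrow> \<forall>a \<in> Hom C Z X. Comp C Z X Y a f = Comp C Z X Y a g"
  shows "f = g"
  using assms(5)[of X] assms(1-4) by (auto dest!: bspec[of _ _ "Ident C X"] simp: Ident_in Ident_Comp)

lemma iso_Ident: "X \<in> Ob C \<Longrightarrow> iso C X X (Ident C X)"
  by (auto simp: iso_def Ident_in Ident_Comp intro!: bexI[of _ "Ident C X"])

end

context cartesian_category
begin

text \<open>By \<open>Pairing_unique\<close> an element of a product is the pair of its projections.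
  As a rewrite rule this splits quantifiers over nested products down to their factors.\<close>

lemma ball_Pairing:
  assumes "Z \<in> Ob C" "X \<in> Ob C" "Y \<in> Ob C"
  shows "(\<forall>a \<in> Hom C Z (X \<boxtimes> Y). \<phi> a) \<longleftrightarrow> (\<forall>b \<in> Hom C Z X. \<forall>c \<in> Hom C Z Y. \<phi> (Pairing C Z X Y b c))"
proof (intro iffI ballI)
  fix a assume *: "\<forall>b \<in> Hom C Z X. \<forall>c \<in> Hom C Z Y. \<phi> (Pairing C Z X Y b c)" and a: "a \<in> Hom C Z (X \<boxtimes> Y)"
  have "Comp C Z (X \<boxtimes> Y) X a (Proj0 C X Y) \<in> Hom C Z X" "Comp C Z (X \<boxtimes> Y) Y a (Proj1 C X Y) \<in> Hom C Z Y"
    using assms a by (simp_all add: Comp_in Prod_Ob Proj0_in Proj1_in)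
  with * have "\<phi> (Pairing C Z X Y (Comp C Z (X \<boxtimes> Y) X a (Proj0 C X Y)) (Comp C Z (X \<boxtimes> Y) Y a (Proj1 C X Y)))"
    by blast
  then show "\<phi> a" using assms a by (simp add: Pairing_unique)
qed (use assms in \<open>simp add: Pairing_in\<close>)

section \<open>Typing and evaluation of the structural maps of products\<close>

lemma Cart_assoc_in: "\<lbrakk>X \<in> Ob C; Y \<in> Ob C; Z \<in> Ob C\<rbrakk>
    \<Longrightarrow> Cart_assoc C X Y Z \<in> Hom C ((X \<boxtimes> Y) \<boxtimes> Z) (X \<boxtimes> (Y \<boxtimes> Z))"
  by (simp add: Cart_assoc_def Let_def Prod_Ob Pairing_in Comp_in Proj0_in Proj1_in)

lemma Cart_assoc_inv_in: "\<lbrakk>X \<in> Ob C; Y \<in> Ob C; Z \<in> Ob C\<rbrakk>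
    \<Longrightarrow> Cart_assoc_inv C X Y Z \<in> Hom C (X \<boxtimes> (Y \<boxtimes> Z)) ((X \<boxtimes> Y) \<boxtimes> Z)"
  by (simp add: Cart_assoc_inv_def Let_def Prod_Ob Pairing_in Comp_in Proj0_in Proj1_in)

lemma Cart_interchange_in: "\<lbrakk>W \<in> Ob C; X \<in> Ob C; Y \<in> Ob C; Z \<in> Ob C\<rbrakk>
    \<Longrightarrow> Cart_interchange C W X Y Z \<in> Hom C ((W \<boxtimes> X) \<boxtimes> (Y \<boxtimes> Z)) ((W \<boxtimes> Y) \<boxtimes> (X \<boxtimes> Z))"
  by (simp add: Cart_interchange_def Prod_Ob Pairing_in Prod_map_in Proj0_in Proj1_in)

lemmas typing = Prod_Ob One_Ob Ident_in Comp_in Proj0_in Proj1_in Pairing_in Bang_in Prod_map_in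
  Cart_assoc_in Cart_assoc_inv_in Cart_interchange_in

lemma Comp_Bang: "\<lbrakk>X \<in> Ob C; Y \<in> Ob C; f \<in> Hom C X Y\<rbrakk> \<Longrightarrow> Comp C X Y (One C) f (Bang C Y) = Bang C X"
  by (simp add: Bang_unique typing)

lemma Pairing_assoc:
  assumes "W \<in> Ob C" "X \<in> Ob C" "Y \<in> Ob C" "Z \<in> Ob C" "a \<in> Hom C W X" "b \<in> Hom C W Y" "c \<in> Hom C W Z"
  shows "Comp C W ((X \<boxtimes> Y) \<boxtimes> Z) (X \<boxtimes> (Y \<boxtimes> Z)) (Pairing C W (X \<boxtimes> Y) Z (Pairing C W X Y a b) c) (Cart_assoc C X Y Z) =
    Pairing C W X (Y \<boxtimes> Z) a (Pairing C W Y Z b c)"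
  using assms by (simp add: Cart_assoc_def Let_def typing Comp_Pairing Comp_Comp Pairing_Proj0 Pairing_Proj1)

lemma Pairing_assoc_inv:
  assumes "W \<in> Ob C" "X \<in> Ob C" "Y \<in> Ob C" "Z \<in> Ob C" "a \<in> Hom C W X" "b \<in> Hom C W Y" "c \<in> Hom C W Z"
  shows "Comp C W (X \<boxtimes> (Y \<boxtimes> Z)) ((X \<boxtimes> Y) \<boxtimes> Z) (Pairing C W X (Y \<boxtimes> Z) a (Pairing C W Y Z b c)) (Cart_assoc_inv C X Y Z) =
    Pairing C W (X \<boxtimes> Y) Z (Pairing C W X Y a b) c"
  using assms by (simp add: Cart_assoc_inv_def Let_def typing Comp_Pairing Comp_Comp Pairing_Proj0 Pairing_Proj1)

text \<open>Specialises \<open>Pairing_interchange\<close> to explicit pairs, so that no projections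
  remain after rewriting.\<close>

lemma Pairing_interchange_Pairing:
  assumes "Z \<in> Ob C" "S \<in> Ob C" "T \<in> Ob C" "U \<in> Ob C" "V \<in> Ob C"
    "a \<in> Hom C Z S" "b \<in> Hom C Z T" "c \<in> Hom C Z U" "d \<in> Hom C Z V"
  shows "Comp C Z ((S \<boxtimes> T) \<boxtimes> (U \<boxtimes> V)) ((S \<boxtimes> U) \<boxtimes> (T \<boxtimes> V))
      (Pairing C Z (S \<boxtimes> T) (U \<boxtimes> V) (Pairing C Z S T a b) (Pairing C Z U V c d)) (Cart_interchange C S T U V) =
    Pairing C Z (S \<boxtimes> U) (T \<boxtimes> V) (Pairing C Z S U a c) (Pairing C Z T V b d)"
  using assms by (simp add: Pairing_interchange typing Pairing_Proj0 Pairing_Proj1)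

text \<open>With these rules \<open>simp\<close> carries an element from the left through a
  composite; structural maps then act on explicit tuples, and both sides of an equation become
  tuples of values.\<close>

lemmas evaluation = Comp_Comp Comp_Ident Comp_Pairing Comp_Bang Pairing_Proj0 Pairing_Proj1
  Pairing_Prod_map Pairing_assoc Pairing_assoc_inv Pairing_interchange_Pairing

lemma Cart_assoc_inverse:
  assumes o: "X \<in> Ob C" "Y \<in> Ob C" "Z \<in> Ob C"
  shows "Comp C ((X \<boxtimes> Y) \<boxtimes> Z) (X \<boxtimes> (Y \<boxtimes> Z)) ((X \<boxtimes> Y) \<boxtimes> Z) (Cart_assoc C X Y Z) (Cart_assoc_inv C X Y Z)
      = Ident C ((X \<boxtimes> Y) \<boxtimes> Z)"
    and "Comp C (X \<boxtimes> (Y \<boxtimes> Z)) ((X \<boxtimes> Y) \<boxtimes> Z) (X \<boxtimes> (Y \<boxtimes> Z)) (Cart_assoc_inv C X Y Z) (Cart_assoc C X Y Z)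
      = Ident C (X \<boxtimes> (Y \<boxtimes> Z))"
proof -
  show "Comp C ((X \<boxtimes> Y) \<boxtimes> Z) (X \<boxtimes> (Y \<boxtimes> Z)) ((X \<boxtimes> Y) \<boxtimes> Z) (Cart_assoc C X Y Z) (Cart_assoc_inv C X Y Z)
      = Ident C ((X \<boxtimes> Y) \<boxtimes> Z)"
    using o by (intro hom_eqI[of "(X \<boxtimes> Y) \<boxtimes> Z" "(X \<boxtimes> Y) \<boxtimes> Z"]) (auto simp: ball_Pairing typing evaluation)
  show "Comp C (X \<boxtimes> (Y \<boxtimes> Z)) ((X \<boxtimes> Y) \<boxtimes> Z) (X \<boxtimes> (Y \<boxtimes> Z)) (Cart_assoc_inv C X Y Z) (Cart_assoc C X Y Z)
      = Ident C (X \<boxtimes> (Y \<boxtimes> Z))"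
    using o by (intro hom_eqI[of "X \<boxtimes> (Y \<boxtimes> Z)" "X \<boxtimes> (Y \<boxtimes> Z)"]) (auto simp: ball_Pairing typing evaluation)
qed

end

section \<open>The bicategory of parametric morphisms\<close>

text \<open>\<open>Left_unitor_Tensor\<close> is a consequence of the pentagon and the triangle by Kelly's argument;
  it is assumed because it is immediate in the instances below.\<close>

locale monoidal_category = category M
  for M :: "('o, 'm) symmetric_monoidal" (structure) +
  assumes Tensor_ob_Ob: "\<lbrakk>X \<in> Ob M; Y \<in> Ob M\<rbrakk> \<Longrightarrow> X \<otimes> Y \<in> Ob M"
    and Unit_Ob: "Unit M \<in> Ob M"
    and Tensor_in: "\<lbrakk>X \<in> Ob M; X' \<in> Ob M; Y \<in> Ob M; Y' \<in> Ob M; f \<in> Hom M X X'; g \<in> Hom M Y Y'\<rbrakk>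
      \<Longrightarrow> Tensor M X X' Y Y' f g \<in> Hom M (X \<otimes> Y) (X' \<otimes> Y')"
    and Tensor_Ident: "\<lbrakk>X \<in> Ob M; Y \<in> Ob M\<rbrakk>
      \<Longrightarrow> Tensor M X X Y Y (Ident M X) (Ident M Y) = Ident M (X \<otimes> Y)"
    and Tensor_Comp: "\<lbrakk>X \<in> Ob M; X' \<in> Ob M; X'' \<in> Ob M; Y \<in> Ob M; Y' \<in> Ob M; Y'' \<in> Ob M;
        f \<in> Hom M X X'; f' \<in> Hom M X' X''; g \<in> Hom M Y Y'; g' \<in> Hom M Y' Y''\<rbrakk>
      \<Longrightarrow> Tensor M X X'' Y Y'' (Comp M X X' X'' f f') (Comp M Y Y' Y'' g g') =
          Comp M (X \<otimes> Y) (X' \<otimes> Y') (X'' \<otimes> Y'') (Tensor M X X' Y Y' f g) (Tensor M X' X'' Y' Y'' f' g')"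
    and Associator_iso: "\<lbrakk>X \<in> Ob M; Y \<in> Ob M; Z \<in> Ob M\<rbrakk>
      \<Longrightarrow> iso M ((X \<otimes> Y) \<otimes> Z) (X \<otimes> (Y \<otimes> Z)) (Associator M X Y Z)"
    and Left_unitor_iso: "X \<in> Ob M \<Longrightarrow> iso M (Unit M \<otimes> X) X (Left_unitor M X)"
    and Right_unitor_iso: "X \<in> Ob M \<Longrightarrow> iso M (X \<otimes> Unit M) X (Right_unitor M X)"
    and Associator_natural: "\<lbrakk>X \<in> Ob M; X' \<in> Ob M; Y \<in> Ob M; Y' \<in> Ob M; Z \<in> Ob M; Z' \<in> Ob M;
        f \<in> Hom M X X'; g \<in> Hom M Y Y'; h \<in> Hom M Z Z'\<rbrakk>
      \<Longrightarrow> Comp M ((X \<otimes> Y) \<otimes> Z) ((X' \<otimes> Y') \<otimes> Z') (X' \<otimes> (Y' \<otimes> Z'))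
            (Tensor M (X \<otimes> Y) (X' \<otimes> Y') Z Z' (Tensor M X X' Y Y' f g) h) (Associator M X' Y' Z') =
          Comp M ((X \<otimes> Y) \<otimes> Z) (X \<otimes> (Y \<otimes> Z)) (X' \<otimes> (Y' \<otimes> Z'))
            (Associator M X Y Z) (Tensor M X X' (Y \<otimes> Z) (Y' \<otimes> Z') f (Tensor M Y Y' Z Z' g h))"
    and Left_unitor_natural: "\<lbrakk>X \<in> Ob M; X' \<in> Ob M; f \<in> Hom M X X'\<rbrakk>
      \<Longrightarrow> Comp M (Unit M \<otimes> X) (Unit M \<otimes> X') X'
            (Tensor M (Unit M) (Unit M) X X' (Ident M (Unit M)) f) (Left_unitor M X') =
          Comp M (Unit M \<otimes> X) X X' (Left_unitor M X) f"
    and Right_unitor_natural: "\<lbrakk>X \<in> Ob M; X' \<in> Ob M; f \<in> Hom M X X'\<rbrakk>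
      \<Longrightarrow> Comp M (X \<otimes> Unit M) (X' \<otimes> Unit M) X'
            (Tensor M X X' (Unit M) (Unit M) f (Ident M (Unit M))) (Right_unitor M X') =
          Comp M (X \<otimes> Unit M) X X' (Right_unitor M X) f"
    and Associator_pentagon: "\<lbrakk>W \<in> Ob M; X \<in> Ob M; Y \<in> Ob M; Z \<in> Ob M\<rbrakk>
      \<Longrightarrow> Comp M (((W \<otimes> X) \<otimes> Y) \<otimes> Z) (W \<otimes> ((X \<otimes> Y) \<otimes> Z)) (W \<otimes> (X \<otimes> (Y \<otimes> Z)))
            (Comp M (((W \<otimes> X) \<otimes> Y) \<otimes> Z) ((W \<otimes> (X \<otimes> Y)) \<otimes> Z) (W \<otimes> ((X \<otimes> Y) \<otimes> Z))
              (Tensor M ((W \<otimes> X) \<otimes> Y) (W \<otimes> (X \<otimes> Y)) Z Z (Associator M W X Y) (Ident M Z))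
              (Associator M W (X \<otimes> Y) Z))
            (Tensor M W W ((X \<otimes> Y) \<otimes> Z) (X \<otimes> (Y \<otimes> Z)) (Ident M W) (Associator M X Y Z)) =
          Comp M (((W \<otimes> X) \<otimes> Y) \<otimes> Z) ((W \<otimes> X) \<otimes> (Y \<otimes> Z)) (W \<otimes> (X \<otimes> (Y \<otimes> Z)))
            (Associator M (W \<otimes> X) Y Z) (Associator M W X (Y \<otimes> Z))"
    and Unitor_triangle: "\<lbrakk>X \<in> Ob M; Y \<in> Ob M\<rbrakk>
      \<Longrightarrow> Comp M ((X \<otimes> Unit M) \<otimes> Y) (X \<otimes> (Unit M \<otimes> Y)) (X \<otimes> Y) (Associator M X (Unit M) Y)
            (Tensor M X X (Unit M \<otimes> Y) Y (Ident M X) (Left_unitor M Y)) =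
          Tensor M (X \<otimes> Unit M) X Y Y (Right_unitor M X) (Ident M Y)"
    and Left_unitor_Tensor: "\<lbrakk>X \<in> Ob M; Y \<in> Ob M\<rbrakk>
      \<Longrightarrow> Comp M ((Unit M \<otimes> X) \<otimes> Y) (Unit M \<otimes> (X \<otimes> Y)) (X \<otimes> Y)
            (Associator M (Unit M) X Y) (Left_unitor M (X \<otimes> Y)) =
          Tensor M (Unit M \<otimes> X) X Y Y (Left_unitor M X) (Ident M Y)"
begin

lemma Associator_in: "\<lbrakk>X \<in> Ob M; Y \<in> Ob M; Z \<in> Ob M\<rbrakk>
    \<Longrightarrow> Associator M X Y Z \<in> Hom M ((X \<otimes> Y) \<otimes> Z) (X \<otimes> (Y \<otimes> Z))"
  using Associator_iso by (auto simp: iso_def)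

lemma Left_unitor_in: "X \<in> Ob M \<Longrightarrow> Left_unitor M X \<in> Hom M (Unit M \<otimes> X) X"
  using Left_unitor_iso by (auto simp: iso_def)

lemma Right_unitor_in: "X \<in> Ob M \<Longrightarrow> Right_unitor M X \<in> Hom M (X \<otimes> Unit M) X"
  using Right_unitor_iso by (auto simp: iso_def)

lemmas typing = Tensor_ob_Ob Unit_Ob Tensor_in Ident_in Comp_in
  Associator_in Left_unitor_in Right_unitor_in

section \<open>Cells of \<open>Para M\<close> and their coherence isomorphisms\<close>

lemma Tensor_Ident_Comp:
  assumes "W \<in> Ob M" "X \<in> Ob M" "Y \<in> Ob M" "Z \<in> Ob M" "f \<in> Hom M X Y" "g \<in> Hom M Y Z"
  shows "Tensor M W W X Z (Ident M W) (Comp M X Y Z f g) =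
    Comp M (W \<otimes> X) (W \<otimes> Y) (W \<otimes> Z) (Tensor M W W X Y (Ident M W) f) (Tensor M W W Y Z (Ident M W) g)"
  using assms by (simp add: Ident_in Ident_Comp flip: Tensor_Comp)

lemma Tensor_Comp_Ident:
  assumes "W \<in> Ob M" "X \<in> Ob M" "Y \<in> Ob M" "Z \<in> Ob M" "f \<in> Hom M X Y" "g \<in> Hom M Y Z"
  shows "Tensor M X Z W W (Comp M X Y Z f g) (Ident M W) =
    Comp M (X \<otimes> W) (Y \<otimes> W) (Z \<otimes> W) (Tensor M X Y W W f (Ident M W)) (Tensor M Y Z W W g (Ident M W))"
  using assms by (simp add: Ident_in Ident_Comp flip: Tensor_Comp)

text \<open>Compatibility has to be checked in one direction only: with \<open>s\<close> inverse to
  \<open>r\<close>, (s \<otimes> X) ; f = ((s ; r) \<otimes> X) ; g = g, so \<open>s\<close> is a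
  2-cell as well. All coherence cells below are handled in this way.\<close>

lemma Para_iso:
  assumes o: "X \<in> Ob M" "Y \<in> Ob M" "P \<in> Ob M" "Q \<in> Ob M"
    and f: "f \<in> Hom M (P \<otimes> X) Y" and g: "g \<in> Hom M (Q \<otimes> X) Y"
    and r: "iso M P Q r" and e: "Comp M (P \<otimes> X) (Q \<otimes> X) Y (Tensor M P Q X X r (Ident M X)) g = f"
  shows "iso (Hom_cat (Para M) X Y) (P, f) (Q, g) r"
proof -
  obtain s where s: "s \<in> Hom M Q P" "Comp M P Q P r s = Ident M P" "Comp M Q P Q s r = Ident M Q"
    and r': "r \<in> Hom M P Q"
    using r by (auto simp: iso_def)
  have "Comp M (Q \<otimes> X) (P \<otimes> X) Y (Tensor M Q P X X s (Ident M X)) f =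
    Comp M (Q \<otimes> X) (Q \<otimes> X) Y (Tensor M Q Q X X (Comp M Q P Q s r) (Ident M X)) g"
    using o s(1) r' f g by (simp add: Tensor_Comp_Ident typing Comp_assoc flip: e)
  then have "Comp M (Q \<otimes> X) (P \<otimes> X) Y (Tensor M Q P X X s (Ident M X)) f = g"
    using o g s(3) by (simp add: Tensor_Ident Ident_Comp typing)
  then show ?thesis using s r' e by (auto simp: iso_def Hom_cat_def Para_def)
qed

lemma Para_Comp1_in:
  assumes "X \<in> Ob M" "Y \<in> Ob M" "Z \<in> Ob M" "f \<in> Cells1 (Para M) X Y" "g \<in> Cells1 (Para M) Y Z"
  shows "Comp1 (Para M) X Y Z f g \<in> Cells1 (Para M) X Z"
  using assms by (auto simp: Para_def typing)

text \<open>\<beta> \<otimes> \<alpha> slides past the associator by naturality; the 2-cell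
  condition on \<alpha> turns u' into u, and the one on \<beta> turns v' into v.\<close>

lemma Para_HComp_in:
  assumes o: "X \<in> Ob M" "Y \<in> Ob M" "Z \<in> Ob M"
    and c: "f \<in> Cells1 (Para M) X Y" "f' \<in> Cells1 (Para M) X Y"
      "g \<in> Cells1 (Para M) Y Z" "g' \<in> Cells1 (Para M) Y Z"
      "\<alpha> \<in> Cells2 (Para M) X Y f f'" "\<beta> \<in> Cells2 (Para M) Y Z g g'"
  shows "HComp (Para M) X Y Z f f' g g' \<alpha> \<beta>
    \<in> Cells2 (Para M) X Z (Comp1 (Para M) X Y Z f g) (Comp1 (Para M) X Y Z f' g')"
proof -
  obtain P u P' u' Q v Q' v' where e: "f = (P, u)" "f' = (P', u')" "g = (Q, v)" "g' = (Q', v')"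
    by (metis surj_pair)
  have m: "P \<in> Ob M" "P' \<in> Ob M" "Q \<in> Ob M" "Q' \<in> Ob M" "\<alpha> \<in> Hom M P P'" "\<beta> \<in> Hom M Q Q'"
    "u' \<in> Hom M (P' \<otimes> X) Y" "v' \<in> Hom M (Q' \<otimes> Y) Z"
    and u: "u = Comp M (P \<otimes> X) (P' \<otimes> X) Y (Tensor M P P' X X \<alpha> (Ident M X)) u'"
    and v: "v = Comp M (Q \<otimes> Y) (Q' \<otimes> Y) Z (Tensor M Q Q' Y Y \<beta> (Ident M Y)) v'"
    using c by (auto simp: Para_def e)
  let ?t = "Tensor M P P' X X \<alpha> (Ident M X)"
  have t: "?t \<in> Hom M (P \<otimes> X) (P' \<otimes> X)" using o m by (simp add: typing)
  have "Comp M ((Q \<otimes> P) \<otimes> X) ((Q' \<otimes> P') \<otimes> X) Z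
      (Tensor M (Q \<otimes> P) (Q' \<otimes> P') X X (Tensor M Q Q' P P' \<beta> \<alpha>) (Ident M X))
      (Comp M ((Q' \<otimes> P') \<otimes> X) (Q' \<otimes> Y) Z
        (Comp M ((Q' \<otimes> P') \<otimes> X) (Q' \<otimes> (P' \<otimes> X)) (Q' \<otimes> Y) (Associator M Q' P' X)
          (Tensor M Q' Q' (P' \<otimes> X) Y (Ident M Q') u')) v') =
    Comp M ((Q \<otimes> P) \<otimes> X) (Q' \<otimes> Y) Z
      (Comp M ((Q \<otimes> P) \<otimes> X) (Q' \<otimes> (P' \<otimes> X)) (Q' \<otimes> Y)
        (Comp M ((Q \<otimes> P) \<otimes> X) ((Q' \<otimes> P') \<otimes> X) (Q' \<otimes> (P' \<otimes> X))
          (Tensor M (Q \<otimes> P) (Q' \<otimes> P') X X (Tensor M Q Q' P P' \<beta> \<alpha>) (Ident M X)) (Associator M Q' P' X))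
        (Tensor M Q' Q' (P' \<otimes> X) Y (Ident M Q') u')) v'"
    using o m by (simp add: typing Comp_assoc)
  also have "\<dots> = Comp M ((Q \<otimes> P) \<otimes> X) (Q' \<otimes> Y) Z
      (Comp M ((Q \<otimes> P) \<otimes> X) (Q \<otimes> (P \<otimes> X)) (Q' \<otimes> Y) (Associator M Q P X)
        (Comp M (Q \<otimes> (P \<otimes> X)) (Q' \<otimes> (P' \<otimes> X)) (Q' \<otimes> Y)
          (Tensor M Q Q' (P \<otimes> X) (P' \<otimes> X) \<beta> ?t)
          (Tensor M Q' Q' (P' \<otimes> X) Y (Ident M Q') u'))) v'"
    using o m t by (simp add: Associator_natural typing Comp_assoc)
  also have "Comp M (Q \<otimes> (P \<otimes> X)) (Q' \<otimes> (P' \<otimes> X)) (Q' \<otimes> Y)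
          (Tensor M Q Q' (P \<otimes> X) (P' \<otimes> X) \<beta> ?t)
          (Tensor M Q' Q' (P' \<otimes> X) Y (Ident M Q') u') = Tensor M Q Q' (P \<otimes> X) Y \<beta> u"
    using o m t by (simp add: u typing Comp_Ident flip: Tensor_Comp)
  \<comment> \<open>The interchange law splits \<beta> \<otimes> u in the order that puts \<beta>
    \<otimes> Y next to v'.\<close>
  also have "\<dots> = Comp M (Q \<otimes> (P \<otimes> X)) (Q \<otimes> Y) (Q' \<otimes> Y)
        (Tensor M Q Q (P \<otimes> X) Y (Ident M Q) u) (Tensor M Q Q' Y Y \<beta> (Ident M Y))"
    using o m t by (simp add: u typing Comp_Ident Ident_Comp flip: Tensor_Comp)
  finally show ?thesis
    using o m by (simp add: e Para_def u v typing Comp_assoc)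
qed

text \<open>Compatibility of \<open>Associator M S Q P\<close> with the two composite maps is the
  pentagon for \<open>S\<close>, \<open>Q\<close>, \<open>P\<close>, \<open>W\<close>, followed by
  naturality of the associator in \<open>u\<close>.\<close>

lemma Para_assoc_cell:
  assumes o: "W \<in> Ob M" "X \<in> Ob M" "Y \<in> Ob M" "Z \<in> Ob M"
    and c: "f \<in> Cells1 (Para M) W X" "g \<in> Cells1 (Para M) X Y" "h \<in> Cells1 (Para M) Y Z"
  shows "iso (Hom_cat (Para M) W Z)
    (Comp1 (Para M) W X Z f (Comp1 (Para M) X Y Z g h)) (Comp1 (Para M) W Y Z (Comp1 (Para M) W X Y f g) h)
    (Cell_assoc (Para M) W X Y Z f g h)"
proof -
  obtain P u Q v S w where e: "f = (P, u)" "g = (Q, v)" "h = (S, w)"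
    by (metis surj_pair)
  have m: "P \<in> Ob M" "Q \<in> Ob M" "S \<in> Ob M" "u \<in> Hom M (P \<otimes> W) X" "v \<in> Hom M (Q \<otimes> X) Y"
    "w \<in> Hom M (S \<otimes> Y) Z"
    using c by (auto simp: Para_def e)
  let ?a = "Tensor M ((S \<otimes> Q) \<otimes> P) (S \<otimes> (Q \<otimes> P)) W W (Associator M S Q P) (Ident M W)"
  let ?b = "Tensor M S S ((Q \<otimes> P) \<otimes> W) (Q \<otimes> (P \<otimes> W)) (Ident M S) (Associator M Q P W)"
  let ?U = "Tensor M S S (Q \<otimes> (P \<otimes> W)) (Q \<otimes> X) (Ident M S) (Tensor M Q Q (P \<otimes> W) X (Ident M Q) u)"
  let ?V = "Tensor M S S (Q \<otimes> X) Y (Ident M S) v"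
  let ?D = "((S \<otimes> Q) \<otimes> P) \<otimes> W"
  have ty: "?a \<in> Hom M ?D ((S \<otimes> (Q \<otimes> P)) \<otimes> W)" "?b \<in> Hom M (S \<otimes> ((Q \<otimes> P) \<otimes> W)) (S \<otimes> (Q \<otimes> (P \<otimes> W)))"
    "?U \<in> Hom M (S \<otimes> (Q \<otimes> (P \<otimes> W))) (S \<otimes> (Q \<otimes> X))" "?V \<in> Hom M (S \<otimes> (Q \<otimes> X)) (S \<otimes> Y)"
    using o m by (simp_all add: typing)
  \<comment> \<open>Tensoring with \<open>S\<close> distributes over the composite of
    \<open>f\<close> and \<open>g\<close>, which exposes \<open>?b\<close> for the pentagon.\<close>
  have 1: "Tensor M S S ((Q \<otimes> P) \<otimes> W) Y (Ident M S)
     (Comp M ((Q \<otimes> P) \<otimes> W) (Q \<otimes> X) Y (Comp M ((Q \<otimes> P) \<otimes> W) (Q \<otimes> (P \<otimes> W)) (Q \<otimes> X) (Associator M Q P W)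
        (Tensor M Q Q (P \<otimes> W) X (Ident M Q) u)) v) =
     Comp M (S \<otimes> ((Q \<otimes> P) \<otimes> W)) (S \<otimes> (Q \<otimes> X)) (S \<otimes> Y)
       (Comp M (S \<otimes> ((Q \<otimes> P) \<otimes> W)) (S \<otimes> (Q \<otimes> (P \<otimes> W))) (S \<otimes> (Q \<otimes> X)) ?b ?U) ?V"
    using o m by (simp add: Tensor_Ident_Comp typing)
  have nat: "Comp M ((S \<otimes> Q) \<otimes> (P \<otimes> W)) (S \<otimes> (Q \<otimes> (P \<otimes> W))) (S \<otimes> (Q \<otimes> X)) (Associator M S Q (P \<otimes> W)) ?U =
     Comp M ((S \<otimes> Q) \<otimes> (P \<otimes> W)) ((S \<otimes> Q) \<otimes> X) (S \<otimes> (Q \<otimes> X))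
       (Tensor M (S \<otimes> Q) (S \<otimes> Q) (P \<otimes> W) X (Ident M (S \<otimes> Q)) u) (Associator M S Q X)"
    using o m Associator_natural[of S S Q Q "P \<otimes> W" X "Ident M S" "Ident M Q" u]
    by (simp add: Tensor_Ident typing)
  have "Comp M ?D ((S \<otimes> (Q \<otimes> P)) \<otimes> W) Z ?a
    (Comp M ((S \<otimes> (Q \<otimes> P)) \<otimes> W) (S \<otimes> Y) Z (Comp M ((S \<otimes> (Q \<otimes> P)) \<otimes> W) (S \<otimes> ((Q \<otimes> P) \<otimes> W)) (S \<otimes> Y)
      (Associator M S (Q \<otimes> P) W)
      (Comp M (S \<otimes> ((Q \<otimes> P) \<otimes> W)) (S \<otimes> (Q \<otimes> X)) (S \<otimes> Y)
       (Comp M (S \<otimes> ((Q \<otimes> P) \<otimes> W)) (S \<otimes> (Q \<otimes> (P \<otimes> W))) (S \<otimes> (Q \<otimes> X)) ?b ?U) ?V)) w) =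
    Comp M ?D (S \<otimes> (Q \<otimes> (P \<otimes> W))) Z
      (Comp M ?D (S \<otimes> ((Q \<otimes> P) \<otimes> W)) (S \<otimes> (Q \<otimes> (P \<otimes> W)))
       (Comp M ?D ((S \<otimes> (Q \<otimes> P)) \<otimes> W) (S \<otimes> ((Q \<otimes> P) \<otimes> W)) ?a (Associator M S (Q \<otimes> P) W)) ?b)
      (Comp M (S \<otimes> (Q \<otimes> (P \<otimes> W))) (S \<otimes> (Q \<otimes> X)) Z ?U
         (Comp M (S \<otimes> (Q \<otimes> X)) (S \<otimes> Y) Z ?V w))"
    using o m ty by (simp add: typing Comp_assoc)
  \<comment> \<open>\<open>?a\<close>, the associator at \<open>S\<close>,
    \<open>Q \<otimes> P\<close>, \<open>W\<close>, and \<open>?b\<close> form the long side of the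
    pentagon.\<close>
  also have "\<dots> = Comp M ?D (S \<otimes> (Q \<otimes> X)) Z
      (Comp M ?D ((S \<otimes> Q) \<otimes> (P \<otimes> W)) (S \<otimes> (Q \<otimes> X)) (Associator M (S \<otimes> Q) P W)
        (Comp M ((S \<otimes> Q) \<otimes> (P \<otimes> W)) (S \<otimes> (Q \<otimes> (P \<otimes> W))) (S \<otimes> (Q \<otimes> X)) (Associator M S Q (P \<otimes> W)) ?U))
         (Comp M (S \<otimes> (Q \<otimes> X)) (S \<otimes> Y) Z ?V w)"
    using o m ty by (subst Associator_pentagon) (simp_all add: typing Comp_assoc)
  finally have key: "Comp M ?D ((S \<otimes> (Q \<otimes> P)) \<otimes> W) Z ?a
    (Comp M ((S \<otimes> (Q \<otimes> P)) \<otimes> W) (S \<otimes> Y) Z (Comp M ((S \<otimes> (Q \<otimes> P)) \<otimes> W) (S \<otimes> ((Q \<otimes> P) \<otimes> W)) (S \<otimes> Y)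
      (Associator M S (Q \<otimes> P) W)
      (Comp M (S \<otimes> ((Q \<otimes> P) \<otimes> W)) (S \<otimes> (Q \<otimes> X)) (S \<otimes> Y)
       (Comp M (S \<otimes> ((Q \<otimes> P) \<otimes> W)) (S \<otimes> (Q \<otimes> (P \<otimes> W))) (S \<otimes> (Q \<otimes> X)) ?b ?U) ?V)) w) =
    Comp M ?D ((S \<otimes> Q) \<otimes> X) Z
      (Comp M ?D ((S \<otimes> Q) \<otimes> (P \<otimes> W)) ((S \<otimes> Q) \<otimes> X) (Associator M (S \<otimes> Q) P W)
        (Tensor M (S \<otimes> Q) (S \<otimes> Q) (P \<otimes> W) X (Ident M (S \<otimes> Q)) u))
      (Comp M ((S \<otimes> Q) \<otimes> X) (S \<otimes> Y) Z
        (Comp M ((S \<otimes> Q) \<otimes> X) (S \<otimes> (Q \<otimes> X)) (S \<otimes> Y) (Associator M S Q X) ?V) w)"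
    unfolding nat using o m ty by (simp add: typing Comp_assoc)
  have "Cell_assoc (Para M) W X Y Z f g h = Associator M S Q P"
    by (simp add: e Para_def)
  moreover have "Comp1 (Para M) W X Z f (Comp1 (Para M) X Y Z g h) = ((S \<otimes> Q) \<otimes> P,
      Comp M ?D ((S \<otimes> Q) \<otimes> X) Z
      (Comp M ?D ((S \<otimes> Q) \<otimes> (P \<otimes> W)) ((S \<otimes> Q) \<otimes> X) (Associator M (S \<otimes> Q) P W)
        (Tensor M (S \<otimes> Q) (S \<otimes> Q) (P \<otimes> W) X (Ident M (S \<otimes> Q)) u))
      (Comp M ((S \<otimes> Q) \<otimes> X) (S \<otimes> Y) Z
        (Comp M ((S \<otimes> Q) \<otimes> X) (S \<otimes> (Q \<otimes> X)) (S \<otimes> Y) (Associator M S Q X) ?V) w))"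
    by (simp add: e Para_def)
  moreover have "Comp1 (Para M) W Y Z (Comp1 (Para M) W X Y f g) h = (S \<otimes> (Q \<otimes> P),
      Comp M ((S \<otimes> (Q \<otimes> P)) \<otimes> W) (S \<otimes> Y) Z (Comp M ((S \<otimes> (Q \<otimes> P)) \<otimes> W) (S \<otimes> ((Q \<otimes> P) \<otimes> W)) (S \<otimes> Y)
      (Associator M S (Q \<otimes> P) W)
      (Comp M (S \<otimes> ((Q \<otimes> P) \<otimes> W)) (S \<otimes> (Q \<otimes> X)) (S \<otimes> Y)
       (Comp M (S \<otimes> ((Q \<otimes> P) \<otimes> W)) (S \<otimes> (Q \<otimes> (P \<otimes> W))) (S \<otimes> (Q \<otimes> X)) ?b ?U) ?V)) w)"
    unfolding 1[symmetric] by (simp add: e Para_def)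
  ultimately show ?thesis
    using o m ty by (auto intro!: Para_iso[OF _ _ _ _ _ _ _ key] Associator_iso simp: typing)
qed

text \<open>Composition reverses the order of parameters, so the identity contributes
  \<open>Unit M\<close> to the right of \<open>P\<close>; the 2-cell condition is then the triangle
  identity.\<close>

lemma Para_lunit_cell:
  assumes o: "X \<in> Ob M" "Y \<in> Ob M" and c: "f \<in> Cells1 (Para M) X Y"
  shows "iso (Hom_cat (Para M) X Y) (Comp1 (Para M) X X Y (Ident1 (Para M) X) f) f (Cell_lunit (Para M) X Y f)"
proof -
  obtain P u where e: "f = (P, u)" by (metis surj_pair)
  have m: "P \<in> Ob M" "u \<in> Hom M (P \<otimes> X) Y" using c by (auto simp: Para_def e)
  let ?I = "Unit M"
  have key: "Comp M ((P \<otimes> ?I) \<otimes> X) (P \<otimes> X) Y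
      (Tensor M (P \<otimes> ?I) P X X (Right_unitor M P) (Ident M X)) u =
    Comp M ((P \<otimes> ?I) \<otimes> X) (P \<otimes> X) Y
     (Comp M ((P \<otimes> ?I) \<otimes> X) (P \<otimes> (?I \<otimes> X)) (P \<otimes> X) (Associator M P ?I X)
        (Tensor M P P (?I \<otimes> X) X (Ident M P) (Left_unitor M X))) u"
    using o m by (simp add: Unitor_triangle)
  have "Comp1 (Para M) X X Y (Ident1 (Para M) X) f = (P \<otimes> ?I, Comp M ((P \<otimes> ?I) \<otimes> X) (P \<otimes> X) Y
     (Comp M ((P \<otimes> ?I) \<otimes> X) (P \<otimes> (?I \<otimes> X)) (P \<otimes> X) (Associator M P ?I X)
        (Tensor M P P (?I \<otimes> X) X (Ident M P) (Left_unitor M X))) u)"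
    "Cell_lunit (Para M) X Y f = Right_unitor M P"
    by (simp_all add: Para_def e)
  then show ?thesis
    unfolding e using o m
    by (auto intro!: Para_iso[OF _ _ _ _ _ _ _ key] Right_unitor_iso simp: typing)
qed

text \<open>Here \<open>Unit M\<close> stands to the left of \<open>P\<close>: naturality of the
  left unitor moves \<open>u\<close> past it, and \<open>Left_unitor_Tensor\<close> identifies what
  remains.\<close>

lemma Para_runit_cell:
  assumes o: "X \<in> Ob M" "Y \<in> Ob M" and c: "f \<in> Cells1 (Para M) X Y"
  shows "iso (Hom_cat (Para M) X Y) (Comp1 (Para M) X Y Y f (Ident1 (Para M) Y)) f (Cell_runit (Para M) X Y f)"
proof -
  obtain P u where e: "f = (P, u)" by (metis surj_pair)
  have m: "P \<in> Ob M" "u \<in> Hom M (P \<otimes> X) Y" using c by (auto simp: Para_def e)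
  let ?I = "Unit M"
  have key: "Comp M ((?I \<otimes> P) \<otimes> X) (P \<otimes> X) Y
      (Tensor M (?I \<otimes> P) P X X (Left_unitor M P) (Ident M X)) u =
    Comp M ((?I \<otimes> P) \<otimes> X) (?I \<otimes> Y) Y
     (Comp M ((?I \<otimes> P) \<otimes> X) (?I \<otimes> (P \<otimes> X)) (?I \<otimes> Y) (Associator M ?I P X)
        (Tensor M ?I ?I (P \<otimes> X) Y (Ident M ?I) u)) (Left_unitor M Y)"
    using o m by (simp add: Left_unitor_natural typing Comp_assoc flip: Left_unitor_Tensor)
  have "Comp1 (Para M) X Y Y f (Ident1 (Para M) Y) = (?I \<otimes> P, Comp M ((?I \<otimes> P) \<otimes> X) (?I \<otimes> Y) Y
     (Comp M ((?I \<otimes> P) \<otimes> X) (?I \<otimes> (P \<otimes> X)) (?I \<otimes> Y) (Associator M ?I P X)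
        (Tensor M ?I ?I (P \<otimes> X) Y (Ident M ?I) u)) (Left_unitor M Y))"
    "Cell_runit (Para M) X Y f = Left_unitor M P"
    by (simp_all add: Para_def e)
  then show ?thesis
    unfolding e using o m
    by (auto intro!: Para_iso[OF _ _ _ _ _ _ _ key] Left_unitor_iso simp: typing)
qed

text \<open>2-cells are morphisms of \<open>M\<close>, so the category laws are inherited; the
  tensor enters in showing that identities and composites again satisfy the condition on
  2-cells.\<close>

lemma category_Hom_cat_Para:
  assumes o: "X \<in> Ob M" "Y \<in> Ob M"
  shows "category (Hom_cat (Para M) X Y)"
proof (unfold_locales, goal_cases)
  case (1 f)
  then show ?case using o by (auto simp: Hom_cat_def Para_def Tensor_Ident Ident_Comp typing)
next
  case (2 f g h r s)
  then show ?case using o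
    by (auto simp: Hom_cat_def Para_def Tensor_Comp_Ident Comp_assoc typing)
qed (use o in \<open>auto simp: Hom_cat_def Para_def Ident_Comp Comp_Ident Comp_assoc\<close>)

text \<open>The remaining equations are between morphisms of \<open>M\<close>, with tensor factors
  reversed: they are the interchange law, naturality, pentagon and triangle of
  \<open>M\<close>.\<close>

lemma bicategory_Para: "bicategory (Para M)"
proof (rule bicategory.intro, goal_cases)
  case (1 X Y)
  then show ?case using category_Hom_cat_Para by (simp add: Para_def)
next
  case (2 X)
  then show ?case by (simp add: Para_def typing)
next
  case (3 X Y Z f g)
  then show ?case using Para_Comp1_in by (simp add: Para_def)
next
  case (4 X Y Z f f' g g' \<alpha> \<beta>)
  then show ?case using Para_HComp_in by (simp add: Para_def)
next
  case (7 W X Y Z f g h)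
  then show ?case using Para_assoc_cell by (simp add: Para_def)
next
  case (8 X Y f)
  then show ?case using Para_lunit_cell by (simp add: Para_def)
next
  case (9 X Y f)
  then show ?case using Para_runit_cell by (simp add: Para_def)
qed (auto simp: Para_def Tensor_Ident Tensor_Comp Associator_natural Left_unitor_natural
  Right_unitor_natural Associator_pentagon Unitor_triangle)
end

section \<open>Strict monoidal functors induce pseudofunctors\<close>

definition Para_map ::
  "('o, 'm) symmetric_monoidal \<Rightarrow> ('p, 'n) symmetric_monoidal \<Rightarrow> ('o \<Rightarrow> 'p) \<Rightarrow> ('o \<Rightarrow> 'o \<Rightarrow> 'm \<Rightarrow> 'n)
    \<Rightarrow> ('o, 'o \<times> 'm, 'm, 'p, 'p \<times> 'n, 'n) bicat_map" where
  "Para_map M N F0 F1 = \<lparr>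
     Fun0 = F0,
     Fun1 = (\<lambda>X Y (P, f). (F0 P, F1 (P \<otimes>\<^bsub>M\<^esub> X) Y f)),
     Fun2 = (\<lambda>X Y (P', f') (P, f) r. F1 P' P r),
     Fun_comp = (\<lambda>X Y Z (P, f) (Q, g). Ident N (F0 (Q \<otimes>\<^bsub>M\<^esub> P))),
     Fun_unit = (\<lambda>X. Ident N (Unit N))\<rparr>"

text \<open>Preservation is required up to equality, which the intended functor satisfies: in lenses
  the tensor of \<open>(X, X)\<close> and \<open>(Y, Y)\<close> is literally the doubled product,
  and likewise for the unit.\<close>

locale strict_monoidal_functor =
  source: monoidal_category M + target: monoidal_category N
  for M :: "('o, 'm) symmetric_monoidal" and N :: "('p, 'n) symmetric_monoidal" +
  fixes F0 :: "'o \<Rightarrow> 'p" and F1 :: "'o \<Rightarrow> 'o \<Rightarrow> 'm \<Rightarrow> 'n"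
  assumes F0_Ob: "X \<in> Ob M \<Longrightarrow> F0 X \<in> Ob N"
    and F1_in: "\<lbrakk>X \<in> Ob M; Y \<in> Ob M; f \<in> Hom M X Y\<rbrakk> \<Longrightarrow> F1 X Y f \<in> Hom N (F0 X) (F0 Y)"
    and F1_Ident: "X \<in> Ob M \<Longrightarrow> F1 X X (Ident M X) = Ident N (F0 X)"
    and F1_Comp: "\<lbrakk>X \<in> Ob M; Y \<in> Ob M; Z \<in> Ob M; f \<in> Hom M X Y; g \<in> Hom M Y Z\<rbrakk>
      \<Longrightarrow> F1 X Z (Comp M X Y Z f g) = Comp N (F0 X) (F0 Y) (F0 Z) (F1 X Y f) (F1 Y Z g)"
    and F0_Tensor_ob: "\<lbrakk>X \<in> Ob M; Y \<in> Ob M\<rbrakk> \<Longrightarrow> F0 (X \<otimes>\<^bsub>M\<^esub> Y) = F0 X \<otimes>\<^bsub>N\<^esub> F0 Y"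
    and F0_Unit: "F0 (Unit M) = Unit N"
    and F1_Tensor: "\<lbrakk>X \<in> Ob M; X' \<in> Ob M; Y \<in> Ob M; Y' \<in> Ob M; f \<in> Hom M X X'; g \<in> Hom M Y Y'\<rbrakk>
      \<Longrightarrow> F1 (X \<otimes>\<^bsub>M\<^esub> Y) (X' \<otimes>\<^bsub>M\<^esub> Y') (Tensor M X X' Y Y' f g) =
          Tensor N (F0 X) (F0 X') (F0 Y) (F0 Y') (F1 X X' f) (F1 Y Y' g)"
    and F1_Associator: "\<lbrakk>X \<in> Ob M; Y \<in> Ob M; Z \<in> Ob M\<rbrakk>
      \<Longrightarrow> F1 ((X \<otimes>\<^bsub>M\<^esub> Y) \<otimes>\<^bsub>M\<^esub> Z) (X \<otimes>\<^bsub>M\<^esub> (Y \<otimes>\<^bsub>M\<^esub> Z)) (Associator M X Y Z) = Associator N (F0 X) (F0 Y) (F0 Z)"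
    and F1_Left_unitor: "X \<in> Ob M \<Longrightarrow> F1 (Unit M \<otimes>\<^bsub>M\<^esub> X) X (Left_unitor M X) = Left_unitor N (F0 X)"
    and F1_Right_unitor: "X \<in> Ob M \<Longrightarrow> F1 (X \<otimes>\<^bsub>M\<^esub> Unit M) X (Right_unitor M X) = Right_unitor N (F0 X)"
begin

lemma F1_in_Tensor: "\<lbrakk>X \<in> Ob M; Y \<in> Ob M; Z \<in> Ob M; f \<in> Hom M (X \<otimes>\<^bsub>M\<^esub> Y) Z\<rbrakk>
    \<Longrightarrow> F1 (X \<otimes>\<^bsub>M\<^esub> Y) Z f \<in> Hom N (F0 X \<otimes>\<^bsub>N\<^esub> F0 Y) (F0 Z)"
  using F1_in[of "X \<otimes>\<^bsub>M\<^esub> Y" Z f] by (simp add: F0_Tensor_ob source.typing)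

lemmas strict = F1_Ident F1_Comp F0_Tensor_ob F0_Unit F1_Tensor F1_Associator F1_Left_unitor F1_Right_unitor

text \<open>Makes source and target of the comparison cell for composites the same 1-cell, so that
  an identity of \<open>N\<close> is a legitimate choice.\<close>

lemma Fun1_Comp1:
  assumes "X \<in> Ob M" "Y \<in> Ob M" "Z \<in> Ob M" "f \<in> Cells1 (Para M) X Y" "g \<in> Cells1 (Para M) Y Z"
  shows "Fun1 (Para_map M N F0 F1) X Z (Comp1 (Para M) X Y Z f g) =
    Comp1 (Para N) (F0 X) (F0 Y) (F0 Z) (Fun1 (Para_map M N F0 F1) X Y f) (Fun1 (Para_map M N F0 F1) Y Z g)"
  using assms by (auto simp: Para_def Para_map_def strict source.typing)

lemma pseudofunctor_Para_map: "pseudofunctor (Para M) (Para N) (Para_map M N F0 F1)"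
proof (intro pseudofunctor.intro pseudofunctor_axioms.intro source.bicategory_Para target.bicategory_Para,
    goal_cases)
  \<comment> \<open>Read backwards, \<open>strict\<close> turns the condition for a 2-cell of
    \<open>Para N\<close> into \<open>F1\<close> applied to the condition in
    \<open>Para M\<close>.\<close>
  case (3 X Y f f' \<alpha>)
  then show ?case
    by (auto simp: Para_def Para_map_def F0_Ob F1_in source.typing simp flip: strict)
next
  \<comment> \<open>The identity is an isomorphism from the image \<open>?h\<close> of the composite
    to itself; \<open>Fun1_Comp1\<close> rewrites its source into the composite of the
    images.\<close>
  case (6 X Y Z f g)
  then have o: "X \<in> Ob M" "Y \<in> Ob M" "Z \<in> Ob M" by (auto simp: Para_def)
  let ?h = "Fun1 (Para_map M N F0 F1) X Z (Comp1 (Para M) X Y Z f g)"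
  have "?h \<in> Cells1 (Para N) (F0 X) (F0 Z)"
    using 6(4,5) o by (auto simp: Para_def Para_map_def strict F0_Ob F1_in F1_in_Tensor source.typing target.typing)
  moreover have "Fun_comp (Para_map M N F0 F1) X Y Z f g = VIdent (Para N) (F0 X) (F0 Z) ?h"
    by (simp add: Para_def Para_map_def case_prod_beta)
  ultimately have "iso (Hom_cat (Para N) (F0 X) (F0 Z)) ?h ?h (Fun_comp (Para_map M N F0 F1) X Y Z f g)"
    using category.iso_Ident[OF target.category_Hom_cat_Para[of "F0 X" "F0 Z"], of ?h] o
    by (simp add: Hom_cat_def F0_Ob)
  then show ?case
    using Fun1_Comp1[OF o 6(4,5)] by (simp add: Para_map_def)
next
  case (7 X)
  then have o: "X \<in> Ob M" by (simp add: Para_def)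
  let ?h = "Ident1 (Para N) (F0 X)"
  have "?h \<in> Cells1 (Para N) (F0 X) (F0 X)"
    using o by (simp add: Para_def F0_Ob target.typing)
  moreover have "Fun_unit (Para_map M N F0 F1) X = VIdent (Para N) (F0 X) (F0 X) ?h"
    by (simp add: Para_def Para_map_def)
  ultimately have "iso (Hom_cat (Para N) (F0 X) (F0 X)) ?h ?h (Fun_unit (Para_map M N F0 F1) X)"
    using category.iso_Ident[OF target.category_Hom_cat_Para[of "F0 X" "F0 X"], of ?h] o
    by (simp add: Hom_cat_def F0_Ob)
  moreover have "Fun1 (Para_map M N F0 F1) X X (Ident1 (Para M) X) = ?h"
    using o by (simp add: Para_def Para_map_def strict)
  ultimately show ?case by (simp add: Para_map_def)
\<comment> \<open>With identities as comparison cells, naturality and coherence collapse to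
  preservation of tensor, associator and unitors.\<close>
qed (auto simp: Para_def Para_map_def Let_def strict F0_Ob F1_in F1_in_Tensor source.typing target.typing
  target.Tensor_Ident target.Ident_Comp target.Comp_Ident)

end

section \<open>Cartesian and lens monoidal structures\<close>

lemma Cartesian_monoidal_simps [simp]:
  "Ob (Cartesian_monoidal D) = Ob D" "Hom (Cartesian_monoidal D) = Hom D"
  "Ident (Cartesian_monoidal D) = Ident D" "Comp (Cartesian_monoidal D) = Comp D"
  "Tensor_ob (Cartesian_monoidal D) = Prod D" "Tensor (Cartesian_monoidal D) = Prod_map D"
  "Unit (Cartesian_monoidal D) = One D" "Associator (Cartesian_monoidal D) = Cart_assoc D"
  "Left_unitor (Cartesian_monoidal D) = (\<lambda>X. Proj1 D (One D) X)"
  "Right_unitor (Cartesian_monoidal D) = (\<lambda>X. Proj0 D X (One D))"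
  by (simp_all add: Cartesian_monoidal_def)

context cartesian_category
begin

text \<open>The terminal object has one element at each stage; this complements
  \<open>ball_Pairing\<close> at factors \<open>One C\<close>.\<close>

lemma ball_Bang: "Z \<in> Ob C \<Longrightarrow> (\<forall>a \<in> Hom C Z (One C). \<phi> a) \<longleftrightarrow> \<phi> (Bang C Z)"
  by (metis Bang_unique Bang_in)

lemma left_unitor_inverse:
  assumes o: "X \<in> Ob C"
  shows "Comp C (One C \<boxtimes> X) X (One C \<boxtimes> X) (Proj1 C (One C) X) (Pairing C X (One C) X (Bang C X) (Ident C X))
      = Ident C (One C \<boxtimes> X)"
    and "Comp C X (One C \<boxtimes> X) X (Pairing C X (One C) X (Bang C X) (Ident C X)) (Proj1 C (One C) X) = Ident C X"
proof -
  show "Comp C (One C \<boxtimes> X) X (One C \<boxtimes> X) (Proj1 C (One C) X) (Pairing C X (One C) X (Bang C X) (Ident C X))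
      = Ident C (One C \<boxtimes> X)"
    using o by (intro hom_eqI[of "One C \<boxtimes> X" "One C \<boxtimes> X"])
      (auto simp: ball_Pairing ball_Bang typing evaluation)
qed (use o in \<open>simp add: typing evaluation\<close>)

lemma right_unitor_inverse:
  assumes o: "X \<in> Ob C"
  shows "Comp C (X \<boxtimes> One C) X (X \<boxtimes> One C) (Proj0 C X (One C)) (Pairing C X X (One C) (Ident C X) (Bang C X))
      = Ident C (X \<boxtimes> One C)"
    and "Comp C X (X \<boxtimes> One C) X (Pairing C X X (One C) (Ident C X) (Bang C X)) (Proj0 C X (One C)) = Ident C X"
proof -
  show "Comp C (X \<boxtimes> One C) X (X \<boxtimes> One C) (Proj0 C X (One C)) (Pairing C X X (One C) (Ident C X) (Bang C X))
      = Ident C (X \<boxtimes> One C)"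
    using o by (intro hom_eqI[of "X \<boxtimes> One C" "X \<boxtimes> One C"])
      (auto simp: ball_Pairing ball_Bang typing evaluation)
qed (use o in \<open>simp add: typing evaluation\<close>)

lemma Prod_map_Ident: "\<lbrakk>X \<in> Ob C; Y \<in> Ob C\<rbrakk> \<Longrightarrow> Prod_map C X X Y Y (Ident C X) (Ident C Y) = Ident C (X \<boxtimes> Y)"
  by (intro hom_eqI[of "X \<boxtimes> Y" "X \<boxtimes> Y"]) (auto simp: ball_Pairing typing evaluation)

lemma Prod_map_Comp: "\<lbrakk>X \<in> Ob C; X' \<in> Ob C; X'' \<in> Ob C; Y \<in> Ob C; Y' \<in> Ob C; Y'' \<in> Ob C;
    f \<in> Hom C X X'; f' \<in> Hom C X' X''; g \<in> Hom C Y Y'; g' \<in> Hom C Y' Y''\<rbrakk>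
  \<Longrightarrow> Prod_map C X X'' Y Y'' (Comp C X X' X'' f f') (Comp C Y Y' Y'' g g') =
      Comp C (X \<boxtimes> Y) (X' \<boxtimes> Y') (X'' \<boxtimes> Y'') (Prod_map C X X' Y Y' f g) (Prod_map C X' X'' Y' Y'' f' g')"
  by (intro hom_eqI[of "X \<boxtimes> Y" "X'' \<boxtimes> Y''"]) (auto simp: ball_Pairing typing evaluation)

lemma monoidal_category_Cartesian: "monoidal_category (Cartesian_monoidal C)"
proof (intro monoidal_category.intro monoidal_category_axioms.intro, goal_cases)
  case 1
  show ?case
    by unfold_locales (auto simp: typing Ident_Comp Comp_Ident Comp_assoc)
next
  case (7 X Y Z)
  then show ?case
    by (auto simp: iso_def typing intro!: bexI[of _ "Cart_assoc_inv C X Y Z"] Cart_assoc_inverse)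
next
  case (8 X)
  then show ?case
    by (auto simp: iso_def typing intro!: bexI[of _ "Pairing C X (One C) X (Bang C X) (Ident C X)"]
      left_unitor_inverse)
next
  case (9 X)
  then show ?case
    by (auto simp: iso_def typing intro!: bexI[of _ "Pairing C X X (One C) (Ident C X) (Bang C X)"]
      right_unitor_inverse)
next
  case (10 X X' Y Y' Z Z')
  then show ?case
    by simp (rule hom_eqI[of "(X \<boxtimes> Y) \<boxtimes> Z" "X' \<boxtimes> (Y' \<boxtimes> Z')"], auto simp: ball_Pairing typing evaluation)
next
  case (11 X X' f)
  then show ?case
    by simp (rule hom_eqI[of "One C \<boxtimes> X" "X'"], auto simp: ball_Pairing typing evaluation)
next
  case (12 X X' f)
  then show ?case
    by simp (rule hom_eqI[of "X \<boxtimes> One C" "X'"], auto simp: ball_Pairing typing evaluation)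
next
  case (13 W X Y Z)
  then show ?case
    by simp (rule hom_eqI[of "((W \<boxtimes> X) \<boxtimes> Y) \<boxtimes> Z" "W \<boxtimes> (X \<boxtimes> (Y \<boxtimes> Z))"],
      auto simp: ball_Pairing typing evaluation)
next
  case (14 X Y)
  then show ?case
    by simp (rule hom_eqI[of "(X \<boxtimes> One C) \<boxtimes> Y" "X \<boxtimes> Y"], auto simp: ball_Pairing typing evaluation)
next
  case (15 X Y)
  then show ?case
    by simp (rule hom_eqI[of "(One C \<boxtimes> X) \<boxtimes> Y" "X \<boxtimes> Y"], auto simp: ball_Pairing typing evaluation)
qed (simp_all add: typing Prod_map_Ident Prod_map_Comp)

end

section \<open>Evaluation and equality of lenses\<close>

lemma Lens_simps [simp]:
  "Ob (Lens\<^sub>A D) = Ob D \<times> Ob D"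
  "Hom (Lens\<^sub>A D) (X, X') (Y, Y') =
     {(f, fs). f \<in> Hom D X Y \<and> fs \<in> Hom D (X \<boxtimes>\<^bsub>D\<^esub> Y') X' \<and> additive_snd D X Y' X' fs}"
  "Ident (Lens\<^sub>A D) (X, X') = (Ident D X, Proj1 D X X')"
  "Comp (Lens\<^sub>A D) (X, X') (Y, Y') (Z, Z') (f, fs) (g, gs) =
     (Comp D X Y Z f g, Back_comp D X X' Y Y' Z' f fs gs)"
  "Tensor_ob (Lens\<^sub>A D) (X, X') (Y, Y') = (X \<boxtimes>\<^bsub>D\<^esub> Y, X' \<boxtimes>\<^bsub>D\<^esub> Y')"
  "Tensor (Lens\<^sub>A D) (X, X') (Y, Y') (W, W') (V, V') (f, fs) (g, gs) =
     (Prod_map D X Y W V f g,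
        Comp D ((X \<boxtimes>\<^bsub>D\<^esub> W) \<boxtimes>\<^bsub>D\<^esub> (Y' \<boxtimes>\<^bsub>D\<^esub> V')) ((X \<boxtimes>\<^bsub>D\<^esub> Y') \<boxtimes>\<^bsub>D\<^esub> (W \<boxtimes>\<^bsub>D\<^esub> V')) (X' \<boxtimes>\<^bsub>D\<^esub> W')
          (Cart_interchange D X W Y' V')
          (Prod_map D (X \<boxtimes>\<^bsub>D\<^esub> Y') X' (W \<boxtimes>\<^bsub>D\<^esub> V') W' fs gs))"
  "Unit (Lens\<^sub>A D) = (One D, One D)"
  "Associator (Lens\<^sub>A D) (X, X') (Y, Y') (Z, Z') =
     Simple_lens D ((X \<boxtimes>\<^bsub>D\<^esub> Y) \<boxtimes>\<^bsub>D\<^esub> Z) ((X' \<boxtimes>\<^bsub>D\<^esub> Y') \<boxtimes>\<^bsub>D\<^esub> Z') (X' \<boxtimes>\<^bsub>D\<^esub> (Y' \<boxtimes>\<^bsub>D\<^esub> Z'))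
       (Cart_assoc D X Y Z) (Cart_assoc_inv D X' Y' Z')"
  "Left_unitor (Lens\<^sub>A D) (X, X') =
     Simple_lens D (One D \<boxtimes>\<^bsub>D\<^esub> X) (One D \<boxtimes>\<^bsub>D\<^esub> X') X'
       (Proj1 D (One D) X) (Pairing D X' (One D) X' (Bang D X') (Ident D X'))"
  "Right_unitor (Lens\<^sub>A D) (X, X') =
     Simple_lens D (X \<boxtimes>\<^bsub>D\<^esub> One D) (X' \<boxtimes>\<^bsub>D\<^esub> One D) X'
       (Proj0 D X (One D)) (Pairing D X' X' (One D) (Ident D X') (Bang D X'))"
  by (simp_all add: Lens\<^sub>A_def)

context cartesian_category
begin

lemma Back_comp_in:
  "\<lbrakk>X \<in> Ob C; X' \<in> Ob C; Y \<in> Ob C; Y' \<in> Ob C; Z' \<in> Ob C;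
     f \<in> Hom C X Y; fs \<in> Hom C (X \<boxtimes> Y') X'; gs \<in> Hom C (Y \<boxtimes> Z') Y'\<rbrakk>
    \<Longrightarrow> Back_comp C X X' Y Y' Z' f fs gs \<in> Hom C (X \<boxtimes> Z') X'"
  by (simp add: Back_comp_def Let_def typing)

text \<open>In element notation the value at \<open>(a, b)\<close> is fs(a, gs(f(a), b)):
  \<open>b\<close> is sent back through \<open>gs\<close> at the point f(a), then through
  \<open>fs\<close> at \<open>a\<close>.\<close>

lemma Pairing_Back_comp:
  "\<lbrakk>X \<in> Ob C; X' \<in> Ob C; Y \<in> Ob C; Y' \<in> Ob C; Z' \<in> Ob C;
     f \<in> Hom C X Y; fs \<in> Hom C (X \<boxtimes> Y') X'; gs \<in> Hom C (Y \<boxtimes> Z') Y';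
     W \<in> Ob C; a \<in> Hom C W X; b \<in> Hom C W Z'\<rbrakk>
    \<Longrightarrow> Comp C W (X \<boxtimes> Z') X' (Pairing C W X Z' a b) (Back_comp C X X' Y Y' Z' f fs gs) =
        Comp C W (X \<boxtimes> Y') X'
          (Pairing C W X Y' a (Comp C W (Y \<boxtimes> Z') Y' (Pairing C W Y Z' (Comp C W X Y a f) b) gs)) fs"
  by (simp add: Back_comp_def Let_def typing evaluation)

text \<open>The backward part has a product as its domain, so testing it on pairs suffices.\<close>

lemma lens_eqI:
  assumes "X \<in> Ob C" "X' \<in> Ob C" "Y \<in> Ob C" "Y' \<in> Ob C" "f \<in> Hom C X Y" "g \<in> Hom C X Y"
    and "fs \<in> Hom C (X \<boxtimes> Y') X'" "gs \<in> Hom C (X \<boxtimes> Y') X'"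
    and "\<And>Z. Z \<in> Ob C \<Longrightarrow> \<forall>a \<in> Hom C Z X. Comp C Z X Y a f = Comp C Z X Y a g"
    and "\<And>Z. Z \<in> Ob C \<Longrightarrow> \<forall>a \<in> Hom C Z X. \<forall>b \<in> Hom C Z Y'.
      Comp C Z (X \<boxtimes> Y') X' (Pairing C Z X Y' a b) fs = Comp C Z (X \<boxtimes> Y') X' (Pairing C Z X Y' a b) gs"
  shows "(f, fs) = (g, gs)"
  using hom_eqI[of X Y f g] hom_eqI[of "X \<boxtimes> Y'" X' fs gs] assms by (simp add: typing ball_Pairing)

end

context cartesian_left_additive_category
begin

section \<open>Sums and zeros in products\<close>

lemma Proj_Add:
  assumes "Z \<in> Ob C" "X \<in> Ob C" "Y \<in> Ob C" "a \<in> Hom C Z (X \<boxtimes> Y)" "b \<in> Hom C Z (X \<boxtimes> Y)"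
  shows "Comp C Z (X \<boxtimes> Y) X (Add C Z (X \<boxtimes> Y) a b) (Proj0 C X Y) =
      Add C Z X (Comp C Z (X \<boxtimes> Y) X a (Proj0 C X Y)) (Comp C Z (X \<boxtimes> Y) X b (Proj0 C X Y))"
    and "Comp C Z (X \<boxtimes> Y) Y (Add C Z (X \<boxtimes> Y) a b) (Proj1 C X Y) =
      Add C Z Y (Comp C Z (X \<boxtimes> Y) Y a (Proj1 C X Y)) (Comp C Z (X \<boxtimes> Y) Y b (Proj1 C X Y))"
  using additive_Proj0[of X Y] additive_Proj1[of X Y] assms by (simp_all add: additive_def)

lemma Proj_Zero:
  assumes "Z \<in> Ob C" "X \<in> Ob C" "Y \<in> Ob C"
  shows "Comp C Z (X \<boxtimes> Y) X (Zero C Z (X \<boxtimes> Y)) (Proj0 C X Y) = Zero C Z X"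
    and "Comp C Z (X \<boxtimes> Y) Y (Zero C Z (X \<boxtimes> Y)) (Proj1 C X Y) = Zero C Z Y"
  using additive_Proj0[of X Y] additive_Proj1[of X Y] assms by (simp_all add: additive_def)

text \<open>Both projections are additive, so uniqueness of pairings determines the sum.\<close>

lemma Add_Pairing:
  assumes "Z \<in> Ob C" "X \<in> Ob C" "Y \<in> Ob C"
    "a \<in> Hom C Z X" "b \<in> Hom C Z Y" "c \<in> Hom C Z X" "d \<in> Hom C Z Y"
  shows "Add C Z (X \<boxtimes> Y) (Pairing C Z X Y a b) (Pairing C Z X Y c d) =
    Pairing C Z X Y (Add C Z X a c) (Add C Z Y b d)"
  using Pairing_unique[of Z X Y "Add C Z (X \<boxtimes> Y) (Pairing C Z X Y a b) (Pairing C Z X Y c d)"] assms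
  by (simp add: Proj_Add evaluation typing Add_in)

lemma Zero_Pairing:
  assumes "Z \<in> Ob C" "X \<in> Ob C" "Y \<in> Ob C"
  shows "Zero C Z (X \<boxtimes> Y) = Pairing C Z X Y (Zero C Z X) (Zero C Z Y)"
  using Pairing_unique[of Z X Y "Zero C Z (X \<boxtimes> Y)"] assms
  by (simp add: Proj_Zero typing Zero_in)

lemma Zero_One: "Z \<in> Ob C \<Longrightarrow> Zero C Z (One C) = Bang C Z"
  by (simp add: Bang_unique One_Ob Zero_in)

lemma Add_Bang: "Z \<in> Ob C \<Longrightarrow> Add C Z (One C) (Bang C Z) (Bang C Z) = Bang C Z"
  by (simp add: Bang_unique Add_in typing)

lemma Zero_Add: "\<lbrakk>X \<in> Ob C; Y \<in> Ob C; f \<in> Hom C X Y\<rbrakk> \<Longrightarrow> Add C X Y (Zero C X Y) f = f"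
  by (simp add: Add_commute[of X Y "Zero C X Y" f] Add_Zero Zero_in)

lemma additive_sndI:
  assumes "\<And>Z. Z \<in> Ob C \<Longrightarrow> \<forall>a \<in> Hom C Z X. \<forall>b \<in> Hom C Z Y. \<forall>c \<in> Hom C Z Y.
      Comp C Z (X \<boxtimes> Y) W (Pairing C Z X Y a (Add C Z Y b c)) f =
      Add C Z W (Comp C Z (X \<boxtimes> Y) W (Pairing C Z X Y a b) f) (Comp C Z (X \<boxtimes> Y) W (Pairing C Z X Y a c) f)"
    and "\<And>Z. Z \<in> Ob C \<Longrightarrow> \<forall>a \<in> Hom C Z X. Comp C Z (X \<boxtimes> Y) W (Pairing C Z X Y a (Zero C Z Y)) f = Zero C Z W"
  shows "additive_snd C X Y W f"
  using assms by (simp add: additive_snd_def)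

lemma Pairing_Add_snd:
  "\<lbrakk>additive_snd C X Y W f; Z \<in> Ob C; a \<in> Hom C Z X; b \<in> Hom C Z Y; c \<in> Hom C Z Y\<rbrakk>
    \<Longrightarrow> Comp C Z (X \<boxtimes> Y) W (Pairing C Z X Y a (Add C Z Y b c)) f =
      Add C Z W (Comp C Z (X \<boxtimes> Y) W (Pairing C Z X Y a b) f) (Comp C Z (X \<boxtimes> Y) W (Pairing C Z X Y a c) f)"
  by (simp add: additive_snd_def)

lemma Pairing_Zero_snd:
  "\<lbrakk>additive_snd C X Y W f; Z \<in> Ob C; a \<in> Hom C Z X\<rbrakk>
    \<Longrightarrow> Comp C Z (X \<boxtimes> Y) W (Pairing C Z X Y a (Zero C Z Y)) f = Zero C Z W"
  by (simp add: additive_snd_def)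

lemmas additive_evaluation = evaluation Comp_Add Comp_Zero Pairing_Back_comp
  Pairing_Add_snd Pairing_Zero_snd

lemmas additive_typing = typing Back_comp_in Add_in Zero_in

text \<open>The varying second argument passes through \<open>gs\<close> and then \<open>fs\<close>,
  while their first arguments f(a) and \<open>a\<close> stay fixed.\<close>

lemma additive_snd_Back_comp:
  "\<lbrakk>X \<in> Ob C; X' \<in> Ob C; Y \<in> Ob C; Y' \<in> Ob C; Z' \<in> Ob C;
     f \<in> Hom C X Y; fs \<in> Hom C (X \<boxtimes> Y') X'; gs \<in> Hom C (Y \<boxtimes> Z') Y';
     additive_snd C X Y' X' fs; additive_snd C Y Z' Y' gs\<rbrakk>
    \<Longrightarrow> additive_snd C X Z' X' (Back_comp C X X' Y Y' Z' f fs gs)"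
  by (rule additive_sndI) (auto simp: additive_typing additive_evaluation)

lemma additive_snd_Proj1:
  "\<lbrakk>X \<in> Ob C; Y \<in> Ob C\<rbrakk> \<Longrightarrow> additive_snd C X Y Y (Proj1 C X Y)"
  by (rule additive_sndI) (auto simp: additive_typing additive_evaluation)

text \<open>The middle interchange separates the two factors, and sums in a product are
  componentwise.\<close>

lemma additive_snd_Tensor:
  "\<lbrakk>X \<in> Ob C; X' \<in> Ob C; Y' \<in> Ob C; W \<in> Ob C; W' \<in> Ob C; V' \<in> Ob C;
     fs \<in> Hom C (X \<boxtimes> Y') X'; gs \<in> Hom C (W \<boxtimes> V') W'; additive_snd C X Y' X' fs; additive_snd C W V' W' gs\<rbrakk>
    \<Longrightarrow> additive_snd C (X \<boxtimes> W) (Y' \<boxtimes> V') (X' \<boxtimes> W')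
      (Comp C ((X \<boxtimes> W) \<boxtimes> (Y' \<boxtimes> V')) ((X \<boxtimes> Y') \<boxtimes> (W \<boxtimes> V')) (X' \<boxtimes> W')
          (Cart_interchange C X W Y' V')
          (Prod_map C (X \<boxtimes> Y') X' (W \<boxtimes> V') W' fs gs))"
  by (rule additive_sndI)
    (auto simp: ball_Pairing Add_Pairing Zero_Pairing additive_typing additive_evaluation)

text \<open>The backward part forgets the point, so additivity of \<open>q\<close> becomes
  additivity in the second argument.\<close>

lemma Simple_lens_in:
  assumes o: "X \<in> Ob C" "X' \<in> Ob C" "Y \<in> Ob C" "Y' \<in> Ob C" "p \<in> Hom C X Y" "q \<in> Hom C Y' X'"
    and q: "additive C Y' X' q"
  shows "Simple_lens C X X' Y' p q \<in> Hom (Lens\<^sub>A C) (X, X') (Y, Y')"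
proof -
  have "additive_snd C X Y' X' (Comp C (X \<boxtimes> Y') Y' X' (Proj1 C X Y') q)"
    using q o by (intro additive_sndI) (auto simp: additive_def additive_typing additive_evaluation)
  then show ?thesis using o by (simp add: Simple_lens_def typing)
qed

lemma additiveI:
  assumes "\<And>Z. Z \<in> Ob C \<Longrightarrow> \<forall>x \<in> Hom C Z X. \<forall>y \<in> Hom C Z X.
        Comp C Z X Y (Add C Z X x y) f = Add C Z Y (Comp C Z X Y x f) (Comp C Z X Y y f)"
    and "\<And>Z. Z \<in> Ob C \<Longrightarrow> Comp C Z X Y (Zero C Z X) f = Zero C Z Y"
  shows "additive C X Y f"
  using assms by (simp add: additive_def)

text \<open>The associator lens and its inverse carry these maps backwards, so both must be
  additive.\<close>

lemma additive_Cart_assoc: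
  "\<lbrakk>X \<in> Ob C; Y \<in> Ob C; Z \<in> Ob C\<rbrakk> \<Longrightarrow> additive C ((X \<boxtimes> Y) \<boxtimes> Z) (X \<boxtimes> (Y \<boxtimes> Z)) (Cart_assoc C X Y Z)"
  "\<lbrakk>X \<in> Ob C; Y \<in> Ob C; Z \<in> Ob C\<rbrakk> \<Longrightarrow> additive C (X \<boxtimes> (Y \<boxtimes> Z)) ((X \<boxtimes> Y) \<boxtimes> Z) (Cart_assoc_inv C X Y Z)"
  by (rule additiveI; simp add: ball_Pairing Add_Pairing Zero_Pairing additive_typing additive_evaluation)+

lemma additive_unitor_inverse:
  "X \<in> Ob C \<Longrightarrow> additive C X (One C \<boxtimes> X) (Pairing C X (One C) X (Bang C X) (Ident C X))"
  "X \<in> Ob C \<Longrightarrow> additive C X (X \<boxtimes> One C) (Pairing C X X (One C) (Ident C X) (Bang C X))"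
  by (rule additiveI; simp add: Add_Pairing Zero_Pairing Zero_One Add_Bang additive_typing additive_evaluation)+

lemma Simple_lens_Comp:
  assumes "X \<in> Ob C" "X' \<in> Ob C" "Y \<in> Ob C" "Y' \<in> Ob C" "Z \<in> Ob C" "Z' \<in> Ob C"
    "p \<in> Hom C X Y" "q \<in> Hom C Y' X'" "p' \<in> Hom C Y Z" "q' \<in> Hom C Z' Y'"
  shows "Comp (Lens\<^sub>A C) (X, X') (Y, Y') (Z, Z') (Simple_lens C X X' Y' p q) (Simple_lens C Y Y' Z' p' q') =
    Simple_lens C X X' Z' (Comp C X Y Z p p') (Comp C Z' Y' X' q' q)"
  unfolding Simple_lens_def Lens_simps
  by (rule lens_eqI[of X X' Z Z']) (use assms in \<open>simp_all add: additive_typing additive_evaluation\<close>)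

lemma Simple_lens_Ident:
  assumes "X \<in> Ob C" "X' \<in> Ob C"
  shows "Simple_lens C X X' X' (Ident C X) (Ident C X') = Ident (Lens\<^sub>A C) (X, X')"
  using assms by (simp add: Simple_lens_def typing Comp_Ident)

text \<open>Simple lenses compose covariantly in the first component and contravariantly in the
  second, so two pairs of inverse maps give inverse lenses.\<close>

lemma iso_Simple_lens:
  assumes o: "X \<in> Ob C" "X' \<in> Ob C" "Y \<in> Ob C" "Y' \<in> Ob C"
    and m: "p \<in> Hom C X Y" "q \<in> Hom C Y X" "p' \<in> Hom C Y' X'" "q' \<in> Hom C X' Y'"
    and a: "additive C Y' X' p'" "additive C X' Y' q'"
    and e: "Comp C X Y X p q = Ident C X" "Comp C Y X Y q p = Ident C Y"
      "Comp C X' Y' X' q' p' = Ident C X'" "Comp C Y' X' Y' p' q' = Ident C Y'"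
  shows "iso (Lens\<^sub>A C) (X, X') (Y, Y') (Simple_lens C X X' Y' p p')"
  unfolding iso_def
  using Simple_lens_in[OF o m(1,3) a(1)] Simple_lens_in[OF o(3,4,1,2) m(2,4) a(2)] o m e
  by (auto simp del: Lens_simps simp: Simple_lens_Comp Simple_lens_Ident
      intro!: bexI[of _ "Simple_lens C Y Y' X' q q'"])

text \<open>Associativity holds because both backward parts send \<open>(a, b)\<close> to fs(a,
  gs(f(a), hs(g(f(a)), b))).\<close>

lemma category_Lens: "category (Lens\<^sub>A C)"
proof (unfold_locales, goal_cases)
  case (3 X Y f)
  obtain X1 X2 Y1 Y2 f1 f2 where e: "X = (X1, X2)" "Y = (Y1, Y2)" "f = (f1, f2)" by (metis surj_pair)
  show ?case
    unfolding e Lens_simps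
    by (rule lens_eqI[of X1 X2 Y1 Y2])
      (use 3 in \<open>auto simp: e additive_typing additive_evaluation Ident_Comp\<close>)
next
  case (4 X Y f)
  obtain X1 X2 Y1 Y2 f1 f2 where e: "X = (X1, X2)" "Y = (Y1, Y2)" "f = (f1, f2)" by (metis surj_pair)
  show ?case
    unfolding e Lens_simps
    by (rule lens_eqI[of X1 X2 Y1 Y2])
      (use 4 in \<open>auto simp: e additive_typing additive_evaluation\<close>)
next
  case (5 W X Y Z f g h)
  obtain X1 X2 Y1 Y2 W1 W2 Z1 Z2 f1 f2 g1 g2 h1 h2 where e: "X = (X1, X2)" "Y = (Y1, Y2)"
    "W = (W1, W2)" "Z = (Z1, Z2)" "f = (f1, f2)" "g = (g1, g2)" "h = (h1, h2)"
    by (metis surj_pair)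
  show ?case
    unfolding e Lens_simps
    by (rule lens_eqI[of W1 W2 Z1 Z2])
      (use 5 in \<open>auto simp: e additive_typing additive_evaluation\<close>)
qed (auto simp: additive_typing additive_snd_Back_comp additive_snd_Proj1)

text \<open>Forward parts repeat the laws of products; backward parts run through the inverse
  structural maps in the opposite order.\<close>

lemma monoidal_category_Lens: "monoidal_category (Lens\<^sub>A C)"
proof (intro monoidal_category.intro monoidal_category_axioms.intro category_Lens, goal_cases)
  case (4 X Y)
  obtain X1 X2 Y1 Y2 where e: "X = (X1, X2)" "Y = (Y1, Y2)" by (metis surj_pair)
  show ?case
    unfolding e Lens_simps
    by (rule lens_eqI[of "X1 \<boxtimes> Y1" "X2 \<boxtimes> Y2" "X1 \<boxtimes> Y1" "X2 \<boxtimes> Y2"])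
      (use 4 in \<open>auto simp: e ball_Pairing additive_typing additive_evaluation\<close>)
next
  case (5 X X' X'' Y Y' Y'' f f' g g')
  obtain X1 X2 X1' X2' X1'' X2'' Y1 Y2 Y1' Y2' Y1'' Y2'' f1 f2 f1' f2' g1 g2 g1' g2' where
    e: "X = (X1, X2)" "X' = (X1', X2')" "X'' = (X1'', X2'')" "Y = (Y1, Y2)" "Y' = (Y1', Y2')" "Y'' = (Y1'', Y2'')"
    "f = (f1, f2)" "f' = (f1', f2')" "g = (g1, g2)" "g' = (g1', g2')" by (metis surj_pair)
  show ?case
    unfolding e Lens_simps
    by (rule lens_eqI[of "X1 \<boxtimes> Y1" "X2 \<boxtimes> Y2" "X1'' \<boxtimes> Y1''" "X2'' \<boxtimes> Y2''"])
      (use 5 in \<open>auto simp: e ball_Pairing additive_typing additive_evaluation\<close>)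
next
  case (6 X Y Z)
  obtain X1 X2 Y1 Y2 Z1 Z2 where e: "X = (X1, X2)" "Y = (Y1, Y2)" "Z = (Z1, Z2)" by (metis surj_pair)
  show ?case
    unfolding e Lens_simps
    \<comment> \<open>The backward part is already the inverse associator, so its own inverse
      \<open>q'\<close> is the associator.\<close>
    by (rule iso_Simple_lens[where q = "Cart_assoc_inv C X1 Y1 Z1" and q' = "Cart_assoc C X2 Y2 Z2"])
      (use 6 in \<open>auto simp: e typing Cart_assoc_inverse additive_Cart_assoc\<close>)
next
  case (7 X)
  obtain X1 X2 where e: "X = (X1, X2)" by (metis surj_pair)
  show ?case
    unfolding e Lens_simps
    by (rule iso_Simple_lens[where q = "Pairing C X1 (One C) X1 (Bang C X1) (Ident C X1)"
          and q' = "Proj1 C (One C) X2"])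
      (use 7 in \<open>auto simp: e typing left_unitor_inverse additive_Proj1 additive_unitor_inverse\<close>)
next
  case (8 X)
  obtain X1 X2 where e: "X = (X1, X2)" by (metis surj_pair)
  show ?case
    unfolding e Lens_simps
    by (rule iso_Simple_lens[where q = "Pairing C X1 X1 (One C) (Ident C X1) (Bang C X1)"
          and q' = "Proj0 C X2 (One C)"])
      (use 8 in \<open>auto simp: e typing right_unitor_inverse additive_Proj0 additive_unitor_inverse\<close>)
next
  case (9 X X' Y Y' Z Z' f g h)
  obtain X1 X2 X1' X2' Y1 Y2 Y1' Y2' Z1 Z2 Z1' Z2' f1 f2 g1 g2 h1 h2 where
    e: "X = (X1, X2)" "X' = (X1', X2')" "Y = (Y1, Y2)" "Y' = (Y1', Y2')" "Z = (Z1, Z2)" "Z' = (Z1', Z2')"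
    "f = (f1, f2)" "g = (g1, g2)" "h = (h1, h2)" by (metis surj_pair)
  show ?case
    unfolding e Lens_simps Simple_lens_def
    by (rule lens_eqI[of "(X1 \<boxtimes> Y1) \<boxtimes> Z1" "(X2 \<boxtimes> Y2) \<boxtimes> Z2" "X1' \<boxtimes> (Y1' \<boxtimes> Z1')" "X2' \<boxtimes> (Y2' \<boxtimes> Z2')"])
      (use 9 in \<open>auto simp: e ball_Pairing additive_typing additive_evaluation\<close>)
next
  case (10 X X' f)
  obtain X1 X2 X1' X2' f1 f2 where
    e: "X = (X1, X2)" "X' = (X1', X2')" "f = (f1, f2)" by (metis surj_pair)
  show ?case
    unfolding e Lens_simps Simple_lens_def
    by (rule lens_eqI[of "One C \<boxtimes> X1" "One C \<boxtimes> X2" "X1'" "X2'"])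
      (use 10 in \<open>auto simp: e ball_Pairing ball_Bang additive_typing additive_evaluation\<close>)
next
  case (11 X X' f)
  obtain X1 X2 X1' X2' f1 f2 where
    e: "X = (X1, X2)" "X' = (X1', X2')" "f = (f1, f2)" by (metis surj_pair)
  show ?case
    unfolding e Lens_simps Simple_lens_def
    by (rule lens_eqI[of "X1 \<boxtimes> One C" "X2 \<boxtimes> One C" "X1'" "X2'"])
      (use 11 in \<open>auto simp: e ball_Pairing ball_Bang additive_typing additive_evaluation\<close>)
next
  case (12 W X Y Z)
  obtain W1 W2 X1 X2 Y1 Y2 Z1 Z2 where
    e: "W = (W1, W2)" "X = (X1, X2)" "Y = (Y1, Y2)" "Z = (Z1, Z2)" by (metis surj_pair)
  show ?case
    unfolding e Lens_simps Simple_lens_def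
    by (rule lens_eqI[of "((W1 \<boxtimes> X1) \<boxtimes> Y1) \<boxtimes> Z1" "((W2 \<boxtimes> X2) \<boxtimes> Y2) \<boxtimes> Z2"
        "W1 \<boxtimes> (X1 \<boxtimes> (Y1 \<boxtimes> Z1))" "W2 \<boxtimes> (X2 \<boxtimes> (Y2 \<boxtimes> Z2))"])
      (use 12 in \<open>auto simp: e ball_Pairing additive_typing additive_evaluation\<close>)
next
  case (13 X Y)
  obtain X1 X2 Y1 Y2 where e: "X = (X1, X2)" "Y = (Y1, Y2)" by (metis surj_pair)
  show ?case
    unfolding e Lens_simps Simple_lens_def
    by (rule lens_eqI[of "(X1 \<boxtimes> One C) \<boxtimes> Y1" "(X2 \<boxtimes> One C) \<boxtimes> Y2" "X1 \<boxtimes> Y1" "X2 \<boxtimes> Y2"])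
      (use 13 in \<open>auto simp: e ball_Pairing ball_Bang additive_typing additive_evaluation\<close>)
next
  case (14 X Y)
  obtain X1 X2 Y1 Y2 where e: "X = (X1, X2)" "Y = (Y1, Y2)" by (metis surj_pair)
  show ?case
    unfolding e Lens_simps Simple_lens_def
    by (rule lens_eqI[of "(One C \<boxtimes> X1) \<boxtimes> Y1" "(One C \<boxtimes> X2) \<boxtimes> Y2" "X1 \<boxtimes> Y1" "X2 \<boxtimes> Y2"])
      (use 14 in \<open>auto simp: e ball_Pairing ball_Bang additive_typing additive_evaluation\<close>)
qed (auto simp: additive_typing additive_snd_Tensor)

end

section \<open>The reverse derivative as a strict monoidal functor\<close>

text \<open>The rules for \<open>Rev\<close> on which the functor to lenses rests. Each of them
  passes to \<open>CoKl C A\<close>, so the locale is instantiated both at \<open>C\<close> and at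
  its coKleisli category.\<close>

locale reverse_differential_category = cartesian_left_additive_category C
  for C :: "('o, 'm) reverse_derivative" (structure) +
  assumes Rev_in: "\<lbrakk>X \<in> Ob C; Y \<in> Ob C; f \<in> Hom C X Y\<rbrakk> \<Longrightarrow> Rev C X Y f \<in> Hom C (X \<boxtimes> Y) X"
    and Rev_additive_snd: "\<lbrakk>X \<in> Ob C; Y \<in> Ob C; f \<in> Hom C X Y\<rbrakk>
      \<Longrightarrow> additive_snd C X Y X (Rev C X Y f)"
    and Rev_Ident: "X \<in> Ob C \<Longrightarrow> Rev C X X (Ident C X) = Proj1 C X X"
    and Rev_Proj0: "\<lbrakk>X \<in> Ob C; Y \<in> Ob C\<rbrakk>
      \<Longrightarrow> Rev C (X \<boxtimes> Y) X (Proj0 C X Y) =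
          Comp C ((X \<boxtimes> Y) \<boxtimes> X) X (X \<boxtimes> Y) (Proj1 C (X \<boxtimes> Y) X) (Inj0 C X Y)"
    and Rev_Proj1: "\<lbrakk>X \<in> Ob C; Y \<in> Ob C\<rbrakk>
      \<Longrightarrow> Rev C (X \<boxtimes> Y) Y (Proj1 C X Y) =
          Comp C ((X \<boxtimes> Y) \<boxtimes> Y) Y (X \<boxtimes> Y) (Proj1 C (X \<boxtimes> Y) Y) (Inj1 C X Y)"
    and Rev_Pairing: "\<lbrakk>X \<in> Ob C; Y \<in> Ob C; Z \<in> Ob C; f \<in> Hom C X Y; g \<in> Hom C X Z\<rbrakk>
      \<Longrightarrow> Rev C X (Y \<boxtimes> Z) (Pairing C X Y Z f g) =
          Add C (X \<boxtimes> (Y \<boxtimes> Z)) X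
            (Comp C (X \<boxtimes> (Y \<boxtimes> Z)) (X \<boxtimes> Y) X
               (Prod_map C X X (Y \<boxtimes> Z) Y (Ident C X) (Proj0 C Y Z)) (Rev C X Y f))
            (Comp C (X \<boxtimes> (Y \<boxtimes> Z)) (X \<boxtimes> Z) X
               (Prod_map C X X (Y \<boxtimes> Z) Z (Ident C X) (Proj1 C Y Z)) (Rev C X Z g))"
    and Rev_Comp: "\<lbrakk>X \<in> Ob C; Y \<in> Ob C; Z \<in> Ob C; f \<in> Hom C X Y; g \<in> Hom C Y Z\<rbrakk>
      \<Longrightarrow> Rev C X Z (Comp C X Y Z f g) = Back_comp C X X Y Y Z f (Rev C X Y f) (Rev C Y Z g)"
begin

section \<open>Reverse derivatives evaluated on elements\<close>

lemma Pairing_Rev_Pairing: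
  "\<lbrakk>X \<in> Ob C; Y \<in> Ob C; Z \<in> Ob C; f \<in> Hom C X Y; g \<in> Hom C X Z;
    W \<in> Ob C; a \<in> Hom C W X; b \<in> Hom C W (Y \<boxtimes> Z)\<rbrakk>
      \<Longrightarrow> Comp C W (X \<boxtimes> (Y \<boxtimes> Z)) X (Pairing C W X (Y \<boxtimes> Z) a b)
            (Rev C X (Y \<boxtimes> Z) (Pairing C X Y Z f g)) =
          Add C W X
            (Comp C W (X \<boxtimes> Y) X (Pairing C W X Y a (Comp C W (Y \<boxtimes> Z) Y b (Proj0 C Y Z))) (Rev C X Y f))
            (Comp C W (X \<boxtimes> Z) X (Pairing C W X Z a (Comp C W (Y \<boxtimes> Z) Z b (Proj1 C Y Z))) (Rev C X Z g))"
  by (simp add: Rev_Pairing Rev_in additive_typing additive_evaluation)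

lemma Pairing_Rev_Proj0:
  "\<lbrakk>X \<in> Ob C; Y \<in> Ob C; W \<in> Ob C; a \<in> Hom C W (X \<boxtimes> Y); b \<in> Hom C W X\<rbrakk>
      \<Longrightarrow> Comp C W ((X \<boxtimes> Y) \<boxtimes> X) (X \<boxtimes> Y) (Pairing C W (X \<boxtimes> Y) X a b) (Rev C (X \<boxtimes> Y) X (Proj0 C X Y)) =
         Pairing C W X Y b (Zero C W Y)"
  by (simp add: Rev_Proj0 Inj0_def additive_typing additive_evaluation)

lemma Pairing_Rev_Proj1:
  "\<lbrakk>X \<in> Ob C; Y \<in> Ob C; W \<in> Ob C; a \<in> Hom C W (X \<boxtimes> Y); b \<in> Hom C W Y\<rbrakk>
      \<Longrightarrow> Comp C W ((X \<boxtimes> Y) \<boxtimes> Y) (X \<boxtimes> Y) (Pairing C W (X \<boxtimes> Y) Y a b) (Rev C (X \<boxtimes> Y) Y (Proj1 C X Y)) =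
         Pairing C W X Y (Zero C W X) b"
  by (simp add: Rev_Proj1 Inj1_def additive_typing additive_evaluation)

text \<open>The rules for zero let sums of injected values \<open>(b, 0)\<close> and
  \<open>(0, c)\<close> reassemble into \<open>(b, c)\<close>.\<close>

lemmas reverse_evaluation = additive_evaluation Rev_Comp
  Pairing_Rev_Pairing Pairing_Rev_Proj0 Pairing_Rev_Proj1
  Add_Pairing Zero_Pairing Add_Zero Zero_Add Zero_One

text \<open>The product map is a pairing of \<open>f\<close> and \<open>g\<close> after the
  projections. The chain rule gives \<open>(R[f](x, x'), 0)\<close> and
  \<open>(0, R[g](y, y'))\<close>, and the pairing rule adds them.\<close>

lemma Rev_Prod_map:
  assumes "X \<in> Ob C" "X' \<in> Ob C" "Y \<in> Ob C" "Y' \<in> Ob C" "f \<in> Hom C X X'" "g \<in> Hom C Y Y'"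
  shows "Rev C (X \<boxtimes> Y) (X' \<boxtimes> Y') (Prod_map C X X' Y Y' f g) =
    Comp C ((X \<boxtimes> Y) \<boxtimes> (X' \<boxtimes> Y')) ((X \<boxtimes> X') \<boxtimes> (Y \<boxtimes> Y')) (X \<boxtimes> Y)
      (Cart_interchange C X Y X' Y') (Prod_map C (X \<boxtimes> X') X (Y \<boxtimes> Y') Y (Rev C X X' f) (Rev C Y Y' g))"
  \<comment> \<open>The instance \<open>Prod_map_def[of _ X]\<close> unfolds the product map under
    \<open>Rev\<close> and leaves the outer one, on \<open>X \<boxtimes> X'\<close>, to
    \<open>Pairing_Prod_map\<close>.\<close>
  by (rule hom_eqI[of "(X \<boxtimes> Y) \<boxtimes> (X' \<boxtimes> Y')" "X \<boxtimes> Y"])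
    (use assms in \<open>simp_all add: Prod_map_def[of _ X] ball_Pairing Rev_in additive_typing reverse_evaluation\<close>)

text \<open>The associator is a tuple of iterated projections, so its reverse derivative is a sum of
  injected components, independent of the point; the sum is the reassociated triple.\<close>

lemma Rev_Cart_assoc:
  assumes "X \<in> Ob C" "Y \<in> Ob C" "Z \<in> Ob C"
  shows "Rev C ((X \<boxtimes> Y) \<boxtimes> Z) (X \<boxtimes> (Y \<boxtimes> Z)) (Cart_assoc C X Y Z) =
    Comp C (((X \<boxtimes> Y) \<boxtimes> Z) \<boxtimes> (X \<boxtimes> (Y \<boxtimes> Z))) (X \<boxtimes> (Y \<boxtimes> Z)) ((X \<boxtimes> Y) \<boxtimes> Z)
      (Proj1 C ((X \<boxtimes> Y) \<boxtimes> Z) (X \<boxtimes> (Y \<boxtimes> Z))) (Cart_assoc_inv C X Y Z)"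
  by (rule hom_eqI[of "((X \<boxtimes> Y) \<boxtimes> Z) \<boxtimes> (X \<boxtimes> (Y \<boxtimes> Z))" "(X \<boxtimes> Y) \<boxtimes> Z"])
    (use assms in \<open>simp_all add: Cart_assoc_def Let_def ball_Pairing Rev_in additive_typing reverse_evaluation\<close>)

lemma strict_monoidal_functor_Rev:
  "strict_monoidal_functor (Cartesian_monoidal C) (Lens\<^sub>A C) (\<lambda>X. (X, X)) (\<lambda>X Y f. (f, Rev C X Y f))"
proof (intro strict_monoidal_functor.intro strict_monoidal_functor_axioms.intro
    monoidal_category_Cartesian monoidal_category_Lens, goal_cases)
  \<comment> \<open>\<open>Inj1\<close> at \<open>One C\<close> is the inverse of the left unitor,
    because the zero map into the terminal object is \<open>Bang\<close>.\<close>
  case (9 X)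
  then show ?case
    by (auto simp: Simple_lens_def Rev_Proj1 Inj1_def Zero_One typing)
next
  case (10 X)
  then show ?case
    by (auto simp: Simple_lens_def Rev_Proj0 Inj0_def Zero_One typing)
qed (auto simp: Simple_lens_def Rev_in Rev_additive_snd Rev_Ident Rev_Comp Rev_Prod_map Rev_Cart_assoc)

end

section \<open>Reverse derivatives on the coKleisli category\<close>

lemma CoKl_simps [simp]:
  "Ob (CoKl C A) = Ob C" "Hom (CoKl C A) X Y = Hom C (A \<boxtimes>\<^bsub>C\<^esub> X) Y"
  "Ident (CoKl C A) X = Proj1 C A X" "Prod (CoKl C A) = Prod C"
  "Proj0 (CoKl C A) X Y =
     Comp C (A \<boxtimes>\<^bsub>C\<^esub> (X \<boxtimes>\<^bsub>C\<^esub> Y)) (X \<boxtimes>\<^bsub>C\<^esub> Y) X (Proj1 C A (X \<boxtimes>\<^bsub>C\<^esub> Y)) (Proj0 C X Y)"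
  "Proj1 (CoKl C A) X Y =
     Comp C (A \<boxtimes>\<^bsub>C\<^esub> (X \<boxtimes>\<^bsub>C\<^esub> Y)) (X \<boxtimes>\<^bsub>C\<^esub> Y) Y (Proj1 C A (X \<boxtimes>\<^bsub>C\<^esub> Y)) (Proj1 C X Y)"
  "Pairing (CoKl C A) Z X Y f g = Pairing C (A \<boxtimes>\<^bsub>C\<^esub> Z) X Y f g"
  "One (CoKl C A) = One C" "Bang (CoKl C A) X = Bang C (A \<boxtimes>\<^bsub>C\<^esub> X)"
  "Add (CoKl C A) X Y f g = Add C (A \<boxtimes>\<^bsub>C\<^esub> X) Y f g" "Zero (CoKl C A) X Y = Zero C (A \<boxtimes>\<^bsub>C\<^esub> X) Y"
  "Rev (CoKl C A) X Y f =
     Comp C (A \<boxtimes>\<^bsub>C\<^esub> (X \<boxtimes>\<^bsub>C\<^esub> Y)) ((A \<boxtimes>\<^bsub>C\<^esub> X) \<boxtimes>\<^bsub>C\<^esub> Y) X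
       (Cart_assoc_inv C A X Y)
       (Comp C ((A \<boxtimes>\<^bsub>C\<^esub> X) \<boxtimes>\<^bsub>C\<^esub> Y) (A \<boxtimes>\<^bsub>C\<^esub> X) X (Rev C (A \<boxtimes>\<^bsub>C\<^esub> X) Y f) (Proj1 C A X))"
  by (simp_all add: CoKl_def)

context reverse_differential_category
begin

text \<open>\<open>Comult_eq\<close> turns the comultiplication into a pairing: the composite takes
  \<open>(a, x)\<close> to g(a, f(a, x)), with \<open>a\<close> a constant parameter.\<close>

lemma CoKl_Comp:
  assumes "A \<in> Ob C" "X \<in> Ob C" "Y \<in> Ob C" "Z \<in> Ob C" "f \<in> Hom C (A \<boxtimes> X) Y" "g \<in> Hom C (A \<boxtimes> Y) Z"
  shows "Comp (CoKl C A) X Y Z f g =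
    Comp C (A \<boxtimes> X) (A \<boxtimes> Y) Z (Pairing C (A \<boxtimes> X) A Y (Proj0 C A X) f) g"
  using assms by (simp add: CoKl_def Comult_eq typing evaluation Ident_Comp)

text \<open>The inherited projections ignore the parameter, so composing with one in the coKleisli
  category is composing with the projection of \<open>C\<close>; universal properties and additivity
  carry over.\<close>

lemma cartesian_left_additive_category_CoKl:
  assumes A: "A \<in> Ob C"
  shows "cartesian_left_additive_category (CoKl C A)"
proof (unfold_locales, goal_cases)
  case (5 W X Y Z f g h)
  then show ?case using A
    by (intro hom_eqI[of "A \<boxtimes> W" Z]) (auto simp: CoKl_Comp ball_Pairing typing evaluation)
next
  case (3 X Y f)
  then show ?case using A
    by (intro hom_eqI[of "A \<boxtimes> X" Y]) (auto simp: CoKl_Comp ball_Pairing typing evaluation)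
next
  case (4 X Y f)
  then show ?case using A
    by (intro hom_eqI[of "A \<boxtimes> X" Y]) (auto simp: CoKl_Comp ball_Pairing typing evaluation)
next
  case (12 Z X Y h)
  then show ?case using A
    by (simp add: CoKl_Comp typing evaluation Pairing_unique)
next
  case (23 X Y)
  then show ?case using A
    by (auto simp: additive_def CoKl_Comp additive_typing additive_evaluation Proj_Add Proj_Zero)
next
  case (24 X Y)
  then show ?case using A
    by (auto simp: additive_def CoKl_Comp additive_typing additive_evaluation Proj_Add Proj_Zero)
qed (use A in \<open>auto simp: CoKl_Comp additive_typing additive_evaluation Add_assoc Add_Zero
  intro: Bang_unique Add_commute\<close>)

text \<open>The reverse derivative in \<open>C\<close> at \<open>((a, x), y)\<close> has a component
  in \<open>A\<close> and one in \<open>X\<close>, and the combinator keeps the second. Each rule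
  follows from the rules of \<open>C\<close> by projecting to \<open>X\<close>.\<close>

lemma reverse_differential_category_CoKl:
  assumes A: "A \<in> Ob C"
  shows "reverse_differential_category (CoKl C A)"
proof (intro reverse_differential_category.intro reverse_differential_category_axioms.intro
    cartesian_left_additive_category_CoKl[OF A], goal_cases)
  case (2 X Y f)
  then show ?case using A Rev_additive_snd[of "A \<boxtimes> X" Y f]
    by (auto simp: additive_snd_def[of "CoKl C A"] CoKl_Comp Rev_in Proj_Add Proj_Zero
        additive_typing additive_evaluation)
next
  case (3 X)
  then show ?case using A
    by simp (rule hom_eqI[of "A \<boxtimes> (X \<boxtimes> X)" X],
      simp_all add: ball_Pairing Rev_in additive_typing reverse_evaluation)
next
  \<comment> \<open>The coKleisli projection is a composite of two projections of \<open>C\<close>;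
    the chain rule gives \<open>(0, (b, 0))\<close>, whose second component is the
    injection.\<close>
  case (4 X Y)
  then show ?case using A
    by simp (rule hom_eqI[of "A \<boxtimes> ((X \<boxtimes> Y) \<boxtimes> X)" "X \<boxtimes> Y"],
      simp_all add: Inj0_def[of "CoKl C A"] CoKl_Comp ball_Pairing Rev_in additive_typing reverse_evaluation)
next
  case (5 X Y)
  then show ?case using A
    by simp (rule hom_eqI[of "A \<boxtimes> ((X \<boxtimes> Y) \<boxtimes> Y)" "X \<boxtimes> Y"],
      simp_all add: Inj1_def[of "CoKl C A"] CoKl_Comp ball_Pairing Rev_in additive_typing reverse_evaluation)
next
  \<comment> \<open>\<open>Proj_Add\<close> distributes the final projection to \<open>X\<close>
    over the sum from the pairing rule.\<close>
  case (6 X Y Z f g)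
  then show ?case using A
    by simp (rule hom_eqI[of "A \<boxtimes> (X \<boxtimes> (Y \<boxtimes> Z))" X],
      simp_all add: Prod_map_def[of "CoKl C A"] CoKl_Comp ball_Pairing Rev_in Proj_Add
        additive_typing reverse_evaluation)
next
  \<comment> \<open>The coKleisli composite is \<open>g\<close> after the pairing of
    \<open>Proj0 C A X\<close> with \<open>f\<close>. If \<open>g\<close> sends back
    \<open>(c, y)\<close>, this pairing sends back \<open>(c, 0)\<close> plus the value of R[f] at
    \<open>y\<close>, and \<open>(c, 0)\<close> vanishes in the \<open>X\<close> component.\<close>
  case (7 X Y Z f g)
  then show ?case using A
    by simp (rule hom_eqI[of "A \<boxtimes> (X \<boxtimes> Z)" X],
      simp_all add: Back_comp_def[of "CoKl C A"] Let_def CoKl_Comp ball_Pairing Rev_in Proj_Add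
        additive_typing reverse_evaluation)
qed (use A in \<open>simp_all add: Rev_in typing\<close>)

end

theorem theorem3:
  fixes C :: "('o, 'm) reverse_derivative" and A :: 'o
  assumes "reverse_derivative_category C" and "A \<in> Ob C"
  shows "let D = CoKl C A;
             B = Para (Cartesian_monoidal D);
             B' = Para (Lens\<^sub>A D)
         in \<exists>F. pseudofunctor B B' F \<and>
              inj_on (Fun0 F) (Cells0 B) \<and>
              (\<forall>X \<in> Cells0 B. Fun0 F X = (X, X)) \<and>
              (\<forall>X \<in> Cells0 B. \<forall>Y \<in> Cells0 B. \<forall>(P, f) \<in> Cells1 B X Y.
                 Fun1 F X Y (P, f) = ((P, P), (f, Rev D (P \<boxtimes>\<^bsub>D\<^esub> X) Y f))) \<and>
              (\<forall>X \<in> Cells0 B. \<forall>Y \<in> Cells0 B. \<forall>(P', f') \<in> Cells1 B X Y. \<forall>(P, f) \<in> Cells1 B X Y.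
                 \<forall>r \<in> Cells2 B X Y (P', f') (P, f).
                   Fun2 F X Y (P', f') (P, f) r = (r, Rev D P' P r))"
proof -
  let ?D = "CoKl C A"
  let ?F = "Para_map (Cartesian_monoidal ?D) (Lens\<^sub>A ?D) (\<lambda>X. (X, X)) (\<lambda>X Y f. (f, Rev ?D X Y f))"
  interpret reverse_derivative_category C by (fact assms)
  have "reverse_differential_category C"
    by unfold_locales (fact Rev_in Rev_additive_snd Rev_Ident Rev_Proj0 Rev_Proj1 Rev_Pairing Rev_Comp)+
  \<comment> \<open>The lenses are those over \<open>CoKl C A\<close>, so the rules are transferred
    there before the functor is formed.\<close>
  then have "reverse_differential_category ?D"
    by (rule reverse_differential_category.reverse_differential_category_CoKl) (fact assms)
  then have "pseudofunctor (Para (Cartesian_monoidal ?D)) (Para (Lens\<^sub>A ?D)) ?F"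
    by (intro strict_monoidal_functor.pseudofunctor_Para_map
        reverse_differential_category.strict_monoidal_functor_Rev)
  \<comment> \<open>Injectivity on objects holds as \<open>X\<close> is a component of
    \<open>(X, X)\<close>; the prescribed values on 1-cells and 2-cells are those of
    \<open>Para_map\<close>.\<close>
  then show ?thesis
    unfolding Let_def by (intro exI[of _ ?F]) (auto simp: Para_map_def inj_on_def)
qed

end
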